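(* Let $\lambda$ be an arbitrary frequency, $\ell\ge 0$, and $(f_N)_{N\ge1}$ a bounded sequence in $H_{\infty,\ell}^{\lambda}[\mathrm{Re}>0]$. Then there is a subsequence $(f_{N_j})_j$ of $(f_N)$ and $f\in H_{\infty,\ell}^{\lambda}[\mathrm{Re}>0]$ such that for every $u>0$ $$f_{N_j}(u+\cdot)\to f(u+\cdot)\quad\text{in } H_{\infty,\ell}^{\lambda}[\mathrm{Re}>0]\text{ as }j\to\infty.$$
   Context: A frequency is a strictly increasing sequence $\lambda=(\lambda_n)_{n\ge 1}$ of non-negative real numbers with $\lambda_n\to\infty$. A $\lambda$-Dirichlet series is a formal series $D=\sum a_n e^{-\lambda_n s}$ with complex coefficients $a_n$. Write $[\mathrm{Re}>\sigma]=\{s\in\mathbb{C}:\mathrm{Re}\,s>\sigma\}$. A $\lambda$-Dirichlet series $D=\sum a_ne^{-\lambda_ns}$ is a $\lambda$-Riesz germ of a holomorphic function $f:[\mathrm{Re}>0]\to\mathbb{C}$ if for some $m\ge 0$ and some $\sigma\ge 0$ one has $f(s)=\lim_{x\to\infty}\sum_{\lambda_n<x}a_ne^{-\lambda_ns}\big(1-\frac{\lambda_n}{x}\big)^m$ for all $s\in[\mathrm{Re}>\sigma]$. For $\ell\ge 0$, $H_{\infty,\ell}^{\lambda}[\mathrm{Re}>0]$ is the linear space of all holomorphic $f:[\mathrm{Re}>0]\to\mathbb{C}$ which have a $\lambda$-Riesz germ and satisfy $\|f\|_{\infty,\ell}=\sup_{\mathrm{Re}\,s>0}\frac{|f(s)|}{(1+|s|)^{\ell}}<\infty$.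 Convergence and boundedness in this space are with respect to $\|\cdot\|_{\infty,\ell}$, and $f(u+\cdot)$ denotes $s\mapsto f(u+s)$. *)

theory Defs
  imports "HOL-Analysis.Analysis"
begin

text \<open>Sequences are indexed by all natural numbers, so index n here is index n + 1 in
  sequences that start at 1.\<close>

definition frequency :: "(nat \<Rightarrow> real) \<Rightarrow> bool" where
  "frequency lam \<longleftrightarrow> strict_mono lam \<and> (\<forall>n. 0 \<le> lam n) \<and> filterlim lam at_top sequentially"

abbreviation half_plane :: "real \<Rightarrow> complex set" where
  "half_plane \<sigma> \<equiv> {s. \<sigma> < Re s}"

text \<open>A formal Dirichlet series is given by its coefficients a. The order m of a Riesz mean
  is an arbitrary real number; the base of the power is positive for all indices in the sum
  when x is positive, so the case m = 0 gives plain partial sums.\<close>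

definition riesz_mean ::
    "(nat \<Rightarrow> real) \<Rightarrow> real \<Rightarrow> (nat \<Rightarrow> complex) \<Rightarrow> real \<Rightarrow> complex \<Rightarrow> complex" where
  "riesz_mean lam m a x s =
     (\<Sum>n | lam n < x. a n * exp (- of_real (lam n) * s) * of_real ((1 - lam n / x) powr m))"

definition riesz_germ ::
    "(nat \<Rightarrow> real) \<Rightarrow> (nat \<Rightarrow> complex) \<Rightarrow> (complex \<Rightarrow> complex) \<Rightarrow> bool" where
  "riesz_germ lam a f \<longleftrightarrow>
     (\<exists>m\<ge>0. \<exists>\<sigma>\<ge>0. \<forall>s\<in>half_plane \<sigma>. ((\<lambda>x. riesz_mean lam m a x s) \<longlongrightarrow> f s) at_top)"

text \<open>Functions on the right half-plane are represented by total functions; the values outside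
  the half-plane play no role. As the supremum is taken in the reals, it is meaningful
  only if the quotients are bounded, as is the case for members of \<open>H_inf\<close>.\<close>

definition norm_inf :: "real \<Rightarrow> (complex \<Rightarrow> complex) \<Rightarrow> real" where
  "norm_inf l f = (SUP s\<in>half_plane 0. norm (f s) / (1 + norm s) powr l)"

definition H_inf :: "(nat \<Rightarrow> real) \<Rightarrow> real \<Rightarrow> (complex \<Rightarrow> complex) set" where
  "H_inf lam l = {f. f holomorphic_on half_plane 0 \<and> (\<exists>a. riesz_germ lam a f) \<and>
     bdd_above ((\<lambda>s. norm (f s) / (1 + norm s) powr l) ` half_plane 0)}"

definition bounded_seq_in_H_inf ::
    "(nat \<Rightarrow> real) \<Rightarrow> real \<Rightarrow> (nat \<Rightarrow> complex \<Rightarrow> complex) \<Rightarrow> bool" where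
  "bounded_seq_in_H_inf lam l F \<longleftrightarrow>
     (\<forall>N. F N \<in> H_inf lam l) \<and> (\<exists>C. \<forall>N. norm_inf l (F N) \<le> C)"

definition converges_in_H_inf ::
    "(nat \<Rightarrow> real) \<Rightarrow> real \<Rightarrow> (nat \<Rightarrow> complex \<Rightarrow> complex) \<Rightarrow> (complex \<Rightarrow> complex) \<Rightarrow> bool" where
  "converges_in_H_inf lam l F f \<longleftrightarrow>
     (\<forall>j. F j \<in> H_inf lam l) \<and> f \<in> H_inf lam l \<and>
     (\<lambda>j. norm_inf l (\<lambda>s. F j s - f s)) \<longlonglongrightarrow> 0"

end

theory Submission
  imports Defs "HOL-Complex_Analysis.Complex_Analysis" "HOL-Probability.Sinc_Integral" "HOL-Real_Asymp.Real_Asymp"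
begin

text \<open>A family bounded in the weighted norm is approximated by its Riesz means of one fixed integer
  order k > l + 1, with an error that is O(1/x) in the weighted norm on every half-plane Re s > u and depends
  on the family only through its bound. This comes from Perron's formula for translates: it represents
  the error at s as the integral over Re w = 1/x of (f (s + w) - f s) exp (x w) / w^(k+1), up to a constant and
  the factor x^(-k), and Cauchy's estimate bounds the difference by |w|. Perron's formula also
  recovers the coefficients from the function. Hence along a subsequence that converges locally uniformly
  (Montel) the coefficients converge, and with them the Riesz means, which are finite sums; the
  uniform approximation turns this into norm convergence and yields a germ for the limit.

  The germs of the given functions may be of any real order and live far to the right, where the
  coefficients may grow arbitrarily fast. Perron's formula still holds there for a very high order, by dominated
  convergence along Riesz means of integer order; differentiation in y lowers the order, and Cauchy's
  theorem moves the line of integration.\<close>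

subsection \<open>Integrals over vertical lines\<close>

text \<open>The obstacle is uniformity: order and abscissa of the germ may vary with N, and the norm
  controls neither. At a fixed order k both disappear, since one side of Perron's formula sees only
  the function and the other only the coefficients. The condition k > l + 1 is integrability: f (s +
  w) - f s costs |w| (1 + |w|)^l, and division by w^(k+1) must leave more than one power of decay.
  The integer taken is \<open>nat \<lceil>l\<rceil> + 2\<close>, which leaves |w|^(-2). The line Re
  w = 1/x is the natural scale: exp (x w) has modulus e there, and |x w|^2 = 1 + (x t)^2. The powers
  x^k then cancel, and the substitution in t leaves exactly the factor 1/x. Coefficients are
  recovered without estimates: the Riesz sum at lam (n + 1) contains only the coefficients up to
  index n, so a triangular system has to be solved. All line integrals are absolutely convergent
  Lebesgue integrals, dominated by a multiple of 1 / (1 + t^2).\<close>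

lemma integrable_inverse_one_plus_square:
  "integrable lborel (\<lambda>t::real. B / (1 + t\<^sup>2))"
proof -
  have "integrable lborel (\<lambda>t::real. inverse (1 + t\<^sup>2))"
    using integrable_inverse_1_plus_square by (simp add: set_integrable_def)
  from integrable_mult_right[OF this, of B] show ?thesis
    by (simp add: divide_inverse)
qed

lemma vertical_line_measurable:
  fixes g :: "complex \<Rightarrow> complex"
  assumes "continuous_on (half_plane 0) g" "0 < c"
  shows "(\<lambda>t. g (Complex c t)) \<in> borel_measurable borel"
proof -
  have "continuous_on UNIV (\<lambda>t. g (Complex c t))"
    using assms by (intro continuous_on_compose2[OF assms(1)] continuous_intros) auto
  then show ?thesis
    by (rule borel_measurable_continuous_onI)
qed

lemma integrable_vertical_line:
  fixes g :: "complex \<Rightarrow> complex"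
  assumes "continuous_on (half_plane 0) g" "0 < c"
    and "\<And>t. norm (g (Complex c t)) \<le> B / (1 + t\<^sup>2)"
  shows "integrable lborel (\<lambda>t. g (Complex c t))"
proof (rule Bochner_Integration.integrable_bound[OF integrable_inverse_one_plus_square[of B]])
  show "(\<lambda>t. g (Complex c t)) \<in> borel_measurable lborel"
    using vertical_line_measurable[OF assms(1,2)] by simp
  show "AE t in lborel. norm (g (Complex c t)) \<le> norm (B / (1 + t\<^sup>2))"
    using assms(3) by (intro AE_I2) (metis abs_of_nonneg norm_ge_zero order_trans real_norm_def)
qed

text \<open>Bridges the two kinds of integral: primitives and the residue theorem speak of finite
  segments, dominated convergence of whole lines.\<close>

lemma truncated_integral_tendsto:
  fixes h :: "real \<Rightarrow> complex"
  assumes "integrable lborel h"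
  shows "(\<lambda>n. \<integral>t. indicator {-real n..real n} t *\<^sub>R h t \<partial>lborel) \<longlonglongrightarrow> (\<integral>t. h t \<partial>lborel)"
proof (rule integral_dominated_convergence[where w = "\<lambda>t. norm (h t)"])
  show "AE t in lborel. (\<lambda>n. indicator {-real n..real n} t *\<^sub>R h t) \<longlonglongrightarrow> h t"
  proof (intro AE_I2)
    fix t :: real
    have "eventually (\<lambda>n. h t = indicator {-real n..real n} t *\<^sub>R h t) sequentially"
      using eventually_ge_at_top[of "nat \<lceil>\<bar>t\<bar>\<rceil>"]
    proof eventually_elim
      case (elim n)
      then have "\<bar>t\<bar> \<le> real n" by linarith
      then show ?case by (auto simp: indicator_def)
    qed
    then show "(\<lambda>n. indicator {-real n..real n} t *\<^sub>R h t) \<longlonglongrightarrow> h t"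
      by (rule Lim_transform_eventually[OF tendsto_const])
  qed
  show "AE t in lborel. norm (indicator {-real n..real n} t *\<^sub>R h t) \<le> norm (h t)" for n
    by (auto simp: indicator_def)
qed (use assms in auto)

lemma convex_half_plane: "convex (half_plane \<sigma>)"
  using convex_halfspace_Re_gt[of \<sigma>] by simp

lemma open_half_plane: "open (half_plane \<sigma>)"
  using open_halfspace_Re_gt[of \<sigma>] by simp

text \<open>A primitive on the convex half-plane takes the place of a rectangular contour: a
  truncated line integral is a difference of two values of \<open>G\<close>, so two such integrals
  differ by the increments of \<open>G\<close> along the two horizontal sides, which vanish as the
  height grows.\<close>

lemma vertical_integral_shift:
  fixes g :: "complex \<Rightarrow> complex"
  assumes holo: "g holomorphic_on half_plane 0" and c: "0 < c1" "c1 \<le> c2"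
    and bound: "\<And>w. c1 \<le> Re w \<Longrightarrow> Re w \<le> c2 \<Longrightarrow> norm (g w) \<le> B / (1 + (Im w)\<^sup>2)"
  shows "(\<integral>t. g (Complex c1 t) \<partial>lborel) = (\<integral>t. g (Complex c2 t) \<partial>lborel)"
proof -
  obtain G where G: "\<And>w. w \<in> half_plane 0 \<Longrightarrow> (G has_field_derivative g w) (at w within half_plane 0)"
    using holomorphic_convex_primitive'[OF convex_half_plane open_half_plane holo] by blast
  have cont: "continuous_on (half_plane 0) g"
    using holo by (rule holomorphic_on_imp_continuous_on)
  define I where "I c n = (\<integral>t. indicator {-real n..real n} t *\<^sub>R g (Complex c t) \<partial>lborel)" for c n
  have I: "I c n = (G (Complex c (real n)) - G (Complex c (- real n))) / \<i>" if "0 < c" for c n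
  proof -
    have "I c n = G (Complex c (real n)) / \<i> - G (Complex c (- real n)) / \<i>"
      unfolding I_def
    proof (rule integral_FTC_atLeastAtMost)
      fix t assume "- real n \<le> t" "t \<le> real n"
      have "(G has_field_derivative g (Complex c t)) (at (Complex c t))"
        using G[of "Complex c t"] that at_within_open[OF _ open_half_plane[of 0], of "Complex c t"] by simp
      moreover have "((\<lambda>t. Complex c t) has_vector_derivative \<i>) (at t within {- real n..real n})"
        unfolding Complex_eq by (auto intro!: derivative_eq_intros)
      ultimately have "((G \<circ> (\<lambda>t. Complex c t)) has_vector_derivative (\<i> * g (Complex c t)))
          (at t within {- real n..real n})"
        using field_vector_diff_chain_within has_field_derivative_at_within by blast
      from has_vector_derivative_divide[OF this, of "\<i>"]
      show "((\<lambda>t. G (Complex c t) / \<i>) has_vector_derivative g (Complex c t))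
          (at t within {- real n..real n})"
        by (simp add: o_def)
    next
      show "continuous_on {- real n..real n} (\<lambda>t. g (Complex c t))"
        using that by (intro continuous_on_compose2[OF cont] continuous_intros) auto
    qed auto
    then show ?thesis by (simp add: field_simps)
  qed
  have lim: "I c \<longlonglongrightarrow> (\<integral>t. g (Complex c t) \<partial>lborel)" if "c1 \<le> c" "c \<le> c2" for c
    unfolding I_def
  proof (intro truncated_integral_tendsto integrable_vertical_line[OF cont])
    show "norm (g (Complex c t)) \<le> B / (1 + t\<^sup>2)" for t
      using bound[of "Complex c t"] that by simp
  qed (use that c in auto)
  \<comment> \<open>Mean value bound along the horizontal side at height t, where Im is constant and
    the bound on g is therefore uniform.\<close>
  have seg: "norm (G (Complex c2 t) - G (Complex c1 t)) \<le> B / (1 + t\<^sup>2) * (c2 - c1)" for t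
  proof -
    have sub: "w \<in> half_plane 0 \<and> c1 \<le> Re w \<and> Re w \<le> c2 \<and> Im w = t"
      if "w \<in> closed_segment (Complex c2 t) (Complex c1 t)" for w
      using that c by (auto simp: closed_segment_same_Im closed_segment_eq_real_ivl split: if_splits)
    have "norm (G (Complex c2 t) - G (Complex c1 t)) \<le> B / (1 + t\<^sup>2) * norm (Complex c2 t - Complex c1 t)"
    proof (rule field_differentiable_bound[where S = "closed_segment (Complex c2 t) (Complex c1 t)"])
      fix w assume "w \<in> closed_segment (Complex c2 t) (Complex c1 t)"
      note w = sub[OF this]
      then show "(G has_field_derivative g w) (at w within closed_segment (Complex c2 t) (Complex c1 t))"
        using sub by (intro has_field_derivative_subset[OF G]) auto
      show "norm (g w) \<le> B / (1 + t\<^sup>2)"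
        using bound[of w] w by auto
    qed auto
    also have "norm (Complex c2 t - Complex c1 t) = c2 - c1"
      using c by (simp add: cmod_def)
    finally show ?thesis .
  qed
  have "(\<lambda>n. I c2 n - I c1 n) \<longlonglongrightarrow> 0"
  proof (rule Lim_null_comparison)
    show "\<forall>\<^sub>F n in sequentially. norm (I c2 n - I c1 n) \<le> 2 * B * (c2 - c1) * inverse (1 + (real n)\<^sup>2)"
    proof (intro always_eventually allI)
      fix n
      have "I c2 n - I c1 n = ((G (Complex c2 (real n)) - G (Complex c1 (real n)))
          - (G (Complex c2 (- real n)) - G (Complex c1 (- real n)))) / \<i>"
        unfolding I[OF c(1)] I[OF less_le_trans[OF c]]
        by (simp only: diff_divide_distrib) (simp only: algebra_simps)
      then have "norm (I c2 n - I c1 n) \<le> norm (G (Complex c2 (real n)) - G (Complex c1 (real n)))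
          + norm (G (Complex c2 (- real n)) - G (Complex c1 (- real n)))"
        by (simp add: norm_divide norm_mult norm_triangle_ineq4)
      also have "\<dots> \<le> 2 * B * (c2 - c1) * inverse (1 + (real n)\<^sup>2)"
        using seg[of "real n"] seg[of "- real n"] by (simp add: divide_inverse algebra_simps)
      finally show "norm (I c2 n - I c1 n) \<le> 2 * B * (c2 - c1) * inverse (1 + (real n)\<^sup>2)" .
    qed
    have "(\<lambda>n. inverse (1 + (real n)\<^sup>2)) \<longlonglongrightarrow> 0"
      by real_asymp
    then show "(\<lambda>n. 2 * B * (c2 - c1) * inverse (1 + (real n)\<^sup>2)) \<longlonglongrightarrow> 0"
      by (rule tendsto_mult_right_zero)
  qed
  moreover have "(\<lambda>n. I c2 n - I c1 n) \<longlonglongrightarrow> (\<integral>t. g (Complex c2 t) \<partial>lborel) - (\<integral>t. g (Complex c1 t) \<partial>lborel)"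
    using c by (intro tendsto_diff lim) auto
  ultimately have "0 = (\<integral>t. g (Complex c2 t) \<partial>lborel) - (\<integral>t. g (Complex c1 t) \<partial>lborel)"
    by (rule LIMSEQ_unique)
  then show ?thesis by simp
qed

lemma one_plus_square_le:
  assumes "0 < c"
  shows "min 1 (c\<^sup>2) * (1 + t\<^sup>2) \<le> (norm (Complex c t))\<^sup>2"
proof -
  have "min 1 (c\<^sup>2) * (1 + t\<^sup>2) = min 1 (c\<^sup>2) + min 1 (c\<^sup>2) * t\<^sup>2"
    by (simp add: algebra_simps)
  also have "\<dots> \<le> c\<^sup>2 + 1 * t\<^sup>2"
    by (intro add_mono mult_right_mono) auto
  finally show ?thesis
    by (simp add: cmod_def)
qed

text \<open>Two of the n powers of |w| supply the decay in Im w; the other n - 2 are bounded below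
  by powers of c. The constant depends only on the left edge c, so it serves a whole strip.\<close>

lemma inverse_power_bound:
  assumes "0 < c" "c \<le> Re w" "2 \<le> n"
  shows "1 / norm w ^ n \<le> (1 / (c ^ (n - 2) * min 1 (c\<^sup>2))) / (1 + (Im w)\<^sup>2)"
proof -
  have m: "0 < min 1 (c\<^sup>2)"
    using assms by simp
  have "c \<le> norm w"
    using assms complex_Re_le_cmod[of w] by linarith
  then have 1: "c ^ (n - 2) \<le> norm w ^ (n - 2)"
    using assms by (intro power_mono) auto
  have "min 1 (c\<^sup>2) * (1 + (Im w)\<^sup>2) \<le> min 1 ((Re w)\<^sup>2) * (1 + (Im w)\<^sup>2)"
    using assms by (intro mult_right_mono min.mono power_mono) auto
  also have "\<dots> \<le> (norm w)\<^sup>2"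
    using one_plus_square_le[of "Re w" "Im w"] assms by simp
  finally have 2: "min 1 (c\<^sup>2) * (1 + (Im w)\<^sup>2) \<le> (norm w)\<^sup>2" .
  have "c ^ (n - 2) * (min 1 (c\<^sup>2) * (1 + (Im w)\<^sup>2)) \<le> norm w ^ (n - 2) * (norm w)\<^sup>2"
    using assms m by (intro mult_mono 1 2) auto
  also have "\<dots> = norm w ^ n"
    using assms by (metis le_add_diff_inverse2 power_add)
  finally have "1 / norm w ^ n \<le> 1 / (c ^ (n - 2) * (min 1 (c\<^sup>2) * (1 + (Im w)\<^sup>2)))"
    using assms m \<open>c \<le> norm w\<close>
    by (intro divide_left_mono mult_pos_pos zero_less_power) (auto simp: add_pos_nonneg)
  then show ?thesis
    by (simp add: mult.assoc)
qed

section \<open>Perron integral of a single exponential over a power\<close>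

lemma exp_over_power_holomorphic:
  "(\<lambda>w. exp (of_real y * w) / w ^ n) holomorphic_on half_plane 0"
  by (intro holomorphic_intros) auto

lemma norm_exp_over_power:
  "norm (exp (of_real y * w) / w ^ n) = exp (y * Re w) * (1 / norm w ^ n)"
  by (simp add: norm_divide norm_power)

text \<open>For y \<le> 0 the exponential has modulus at most 1 on the half-plane, so the line can
  be pushed to the right, where the integral tends to 0.\<close>

lemma perron_power_nonpos:
  assumes "0 < c" "2 \<le> M" "y \<le> 0"
  shows "(\<integral>t. exp (of_real y * Complex c t) / Complex c t ^ Suc M \<partial>lborel) = 0"
proof -
  let ?g = "\<lambda>w::complex. exp (of_real y * w) / w ^ Suc M"
  let ?I = "\<lambda>c. \<integral>t. ?g (Complex c t) \<partial>lborel"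
  define K :: real where "K = (\<integral>t. 1 / (1 + t\<^sup>2) \<partial>lborel)"
  have g_le: "norm (?g w) \<le> 1 / norm w ^ Suc M" if "0 < Re w" for w
  proof -
    have "exp (y * Re w) \<le> 1"
      using that assms by (simp add: mult_nonpos_nonneg)
    then have "exp (y * Re w) * (1 / norm w ^ Suc M) \<le> 1 * (1 / norm w ^ Suc M)"
      by (intro mult_right_mono) auto
    then show ?thesis unfolding norm_exp_over_power by simp
  qed
  \<comment> \<open>Since M \<ge> 2, at least one power of c' is left after two have been spent on
    integrability; it produces the decay in c'.\<close>
  have le: "norm (?I c) \<le> K / c'" if "c \<le> c'" "1 \<le> c'" for c'
  proof -
    have "?I c = ?I c'"
    proof (rule vertical_integral_shift[where B = "1 / (c ^ (Suc M - 2) * min 1 (c\<^sup>2))"])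
      fix w assume "c \<le> Re w"
      then show "norm (?g w) \<le> (1 / (c ^ (Suc M - 2) * min 1 (c\<^sup>2))) / (1 + (Im w)\<^sup>2)"
        using assms by (intro order_trans[OF g_le inverse_power_bound]) auto
    qed (use that assms in \<open>simp_all add: exp_over_power_holomorphic del: power_Suc\<close>)
    also have "norm \<dots> \<le> (\<integral>t. (1 / c') / (1 + t\<^sup>2) \<partial>lborel)"
    proof (rule Bochner_Integration.integral_norm_bound_integral)
      have bd: "norm (?g (Complex c' t)) \<le> (1 / c') / (1 + t\<^sup>2)" for t
      proof -
        have "c' \<le> c' ^ (Suc M - 2)"
          using power_increasing[of 1 "Suc M - 2" c'] that assms by simp
        moreover have "min 1 (c'\<^sup>2) = 1"
          using that by (simp add: one_le_power min_def)
        ultimately have "1 / (c' ^ (Suc M - 2) * min 1 (c'\<^sup>2)) \<le> 1 / c'"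
          using that by (simp add: frac_le)
        then have "(1 / (c' ^ (Suc M - 2) * min 1 (c'\<^sup>2))) / (1 + t\<^sup>2) \<le> (1 / c') / (1 + t\<^sup>2)"
          by (intro divide_right_mono) auto
        then show ?thesis
          using inverse_power_bound[of c' "Complex c' t" "Suc M"] g_le[of "Complex c' t"] that assms
          by (simp del: power_Suc)
      qed
      then show "norm (?g (Complex c' t)) \<le> (1 / c') / (1 + t\<^sup>2)" for t .
      show "integrable lborel (\<lambda>t. ?g (Complex c' t))"
        using that bd
        by (intro integrable_vertical_line[where g = ?g and B = "1 / c'"] holomorphic_on_imp_continuous_on
            exp_over_power_holomorphic) auto
    qed (rule integrable_inverse_one_plus_square)
    also have "\<dots> = K / c'"
      unfolding K_def
      by (simp add: mult.commute flip: integral_divide_zero)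
    finally show ?thesis .
  qed
  have "norm (?I c) \<le> 0"
  proof (rule tendsto_lowerbound)
    show "((\<lambda>c'. K / c') \<longlongrightarrow> 0) at_top"
      by real_asymp
    show "\<forall>\<^sub>F c' in at_top. norm (?I c) \<le> K / c'"
      using eventually_ge_at_top[of "max c 1"] by eventually_elim (use le in auto)
  qed auto
  then show ?thesis by simp
qed

lemma contour_integral_rectpath:
  assumes "continuous_on (path_image (rectpath a1 a3)) f"
  shows "contour_integral (rectpath a1 a3) f =
    contour_integral (linepath a1 (Complex (Re a3) (Im a1))) f
    + contour_integral (linepath (Complex (Re a3) (Im a1)) a3) f
    + contour_integral (linepath a3 (Complex (Re a1) (Im a3))) f
    + contour_integral (linepath (Complex (Re a1) (Im a3)) a1) f"
proof -
  define a2 a4 where "a2 = Complex (Re a3) (Im a1)" and "a4 = Complex (Re a1) (Im a3)"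
  have "path_image (rectpath a1 a3) = closed_segment a1 a2 \<union> closed_segment a2 a3
      \<union> closed_segment a3 a4 \<union> closed_segment a4 a1"
    by (simp add: rectpath_def Let_def path_image_join a2_def a4_def Un_assoc)
  then have "f contour_integrable_on linepath a1 a2" "f contour_integrable_on linepath a2 a3"
    "f contour_integrable_on linepath a3 a4" "f contour_integrable_on linepath a4 a1"
    using assms by (auto intro!: contour_integrable_continuous_linepath intro: continuous_on_subset)
  then have "contour_integral (rectpath a1 a3) f =
    contour_integral (linepath a1 a2) f + contour_integral (linepath a2 a3) f
    + contour_integral (linepath a3 a4) f + contour_integral (linepath a4 a1) f"
    by (simp add: rectpath_def Let_def flip: a2_def a4_def)
  then show ?thesis by (simp add: a2_def a4_def)
qed

text \<open>For y > 0 the exponential stays bounded to the left, so the line is closed there by a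
  growing rectangle around the pole at 0. The residue is the coefficient of w^M in exp (y
  w).\<close>

lemma perron_power_pos:
  assumes "0 < c" "2 \<le> M" "0 < y"
  shows "(\<integral>t. exp (of_real y * Complex c t) / Complex c t ^ Suc M \<partial>lborel) = of_real (2 * pi * y ^ M / fact M)"
proof -
  let ?g = "\<lambda>w::complex. exp (of_real y * w) / w ^ Suc M"
  define R where "R = complex_of_real (y ^ M / fact M)"
  \<comment> \<open>The exponent 3 is the least value of \<open>Suc M\<close> for M \<ge> 2. It
    beats the length of the three auxiliary sides, which grows linearly in n.\<close>
  have bd: "norm (?g w) \<le> exp (y * c) / n ^ 3"
    if "1 \<le> n" "n \<le> \<bar>Re w\<bar> \<or> n \<le> \<bar>Im w\<bar>" "Re w \<le> c" for w and n :: real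
  proof -
    have "n \<le> norm w"
      using that abs_Re_le_cmod[of w] abs_Im_le_cmod[of w] by linarith
    then have "n ^ Suc M \<le> norm w ^ Suc M"
      using that by (intro power_mono) auto
    moreover have "n ^ 3 \<le> n ^ Suc M"
      using that assms by (intro power_increasing) auto
    ultimately have "n ^ 3 \<le> norm w ^ Suc M" by linarith
    moreover have "exp (y * Re w) \<le> exp (y * c)"
      using that assms by simp
    ultimately have "exp (y * Re w) / norm w ^ Suc M \<le> exp (y * c) / n ^ 3"
      using that by (intro frac_le) auto
    then show ?thesis unfolding norm_exp_over_power by simp
  qed
  have cont: "continuous_on (half_plane 0) ?g"
    by (intro holomorphic_on_imp_continuous_on exp_over_power_holomorphic)
  have int: "integrable lborel (\<lambda>t. ?g (Complex c t))"
  proof (rule integrable_vertical_line[OF cont, where B = "exp (y * c) * (1 / (c ^ (Suc M - 2) * min 1 (c\<^sup>2)))"])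
    fix t
    have "exp (y * c) * (1 / norm (Complex c t) ^ Suc M) \<le>
      exp (y * c) * ((1 / (c ^ (Suc M - 2) * min 1 (c\<^sup>2))) / (1 + t\<^sup>2))"
      using inverse_power_bound[of c "Complex c t" "Suc M"] assms
      by (intro mult_left_mono) (auto simp del: power_Suc)
    then show "norm (?g (Complex c t)) \<le> exp (y * c) * (1 / (c ^ (Suc M - 2) * min 1 (c\<^sup>2))) / (1 + t\<^sup>2)"
      unfolding norm_exp_over_power by simp
  qed (use assms in auto)
  define I where "I n = (\<integral>t. indicator {-real n..real n} t *\<^sub>R ?g (Complex c t) \<partial>lborel)" for n
  have close: "norm (2 * of_real pi * R - I n) \<le> 4 * exp (y * c) * (real n + c) / real n ^ 3" if "1 \<le> n" for n
  proof -
    define T where "T = real n"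
    have T: "1 \<le> T" using that by (simp add: T_def)
    define a1 a2 a3 a4 where "a1 = Complex (- T) (- T)" and "a2 = Complex c (- T)"
      and "a3 = Complex c T" and "a4 = Complex (- T) T"
    have inbox: "0 \<in> box a1 a3"
      using T assms by (auto simp: a1_def a3_def in_box_complex_iff)
    have img: "path_image (rectpath a1 a3) \<subseteq> UNIV - {0}"
      using path_image_rectpath_cbox_minus_box[of a1 a3] inbox T assms
      by (auto simp: a1_def a3_def)
    have res: "residue ?g 0 = R"
      using residue_fps_expansion_over_power_at_0[OF has_fps_expansion_exp[of "complex_of_real y"], of M]
      by (simp add: R_def)
    have "contour_integral (rectpath a1 a3) ?g = of_real (2 * pi) * \<i> * (\<Sum>p\<in>{0}. winding_number (rectpath a1 a3) p * residue ?g p)"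
    proof (rule Residue_theorem)
      show "?g holomorphic_on UNIV - {0}"
        by (intro holomorphic_intros) auto
    qed (use img in auto)
    then have total: "contour_integral (rectpath a1 a3) ?g = 2 * of_real pi * \<i> * R"
      using winding_number_rectpath[OF inbox] res by simp
    have cont0: "continuous_on (UNIV - {0}) ?g"
      by (intro continuous_intros) auto
    have split: "contour_integral (rectpath a1 a3) ?g =
        contour_integral (linepath a1 a2) ?g + contour_integral (linepath a2 a3) ?g
        + contour_integral (linepath a3 a4) ?g + contour_integral (linepath a4 a1) ?g"
      using contour_integral_rectpath[OF continuous_on_subset[OF cont0 img]]
      by (simp add: a1_def a2_def a3_def a4_def)
    have right: "contour_integral (linepath a2 a3) ?g = \<i> * I n"
    proof -
      have "contour_integral (linepath a2 a3) ?g = \<i> * integral {-T..T} (\<lambda>t. ?g (Complex c t))"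
        using T by (intro contour_integral_linepath_same_Re) (auto simp: a2_def a3_def)
      also have "integral {-T..T} (\<lambda>t. ?g (Complex c t)) = I n"
      proof -
        have "set_integrable lborel {-T..T} (\<lambda>t. ?g (Complex c t))"
          unfolding set_integrable_def using int by (intro integrable_mult_indicator) auto
        from set_borel_integral_eq_integral(2)[OF this] show ?thesis
          by (simp add: I_def set_lebesgue_integral_def T_def)
      qed
      finally show ?thesis .
    qed
    have seg: "norm (contour_integral (linepath a b) ?g) \<le> exp (y * c) / T ^ 3 * norm (b - a)"
      if "\<And>w. w \<in> closed_segment a b \<Longrightarrow> (T \<le> \<bar>Re w\<bar> \<or> T \<le> \<bar>Im w\<bar>) \<and> Re w \<le> c" for a b
    proof (rule contour_integral_bound_linepath)
      have "0 \<notin> closed_segment a b"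
        using that[of 0] T by auto
      then show "?g contour_integrable_on linepath a b"
        by (intro contour_integrable_continuous_linepath continuous_on_subset[OF cont0]) auto
    qed (use bd T that in auto)
    have s1: "norm (contour_integral (linepath a1 a2) ?g) \<le> exp (y * c) / T ^ 3 * (T + c)"
    proof -
      have "norm (a2 - a1) = T + c"
        using T assms by (simp add: a1_def a2_def cmod_def)
      moreover have "norm (contour_integral (linepath a1 a2) ?g) \<le> exp (y * c) / T ^ 3 * norm (a2 - a1)"
        by (rule seg) (use T assms in \<open>auto simp: a1_def a2_def closed_segment_same_Im closed_segment_eq_real_ivl split: if_splits\<close>)
      ultimately show ?thesis by simp
    qed
    have s3: "norm (contour_integral (linepath a3 a4) ?g) \<le> exp (y * c) / T ^ 3 * (T + c)"
    proof -
      have "norm (a4 - a3) = T + c"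
        using T assms by (simp add: a3_def a4_def cmod_def)
      moreover have "norm (contour_integral (linepath a3 a4) ?g) \<le> exp (y * c) / T ^ 3 * norm (a4 - a3)"
        by (rule seg) (use T assms in \<open>auto simp: a3_def a4_def closed_segment_same_Im closed_segment_eq_real_ivl split: if_splits\<close>)
      ultimately show ?thesis by simp
    qed
    have s4: "norm (contour_integral (linepath a4 a1) ?g) \<le> exp (y * c) / T ^ 3 * (2 * T)"
    proof -
      have "norm (a1 - a4) = 2 * T"
        using T assms by (simp add: a1_def a4_def cmod_def real_sqrt_mult)
      moreover have "norm (contour_integral (linepath a4 a1) ?g) \<le> exp (y * c) / T ^ 3 * norm (a1 - a4)"
        by (rule seg) (use T assms in \<open>auto simp: a1_def a4_def closed_segment_same_Re closed_segment_eq_real_ivl split: if_splits\<close>)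
      ultimately show ?thesis by simp
    qed
    have "\<i> * (2 * of_real pi * R - I n) = contour_integral (linepath a1 a2) ?g
        + contour_integral (linepath a3 a4) ?g + contour_integral (linepath a4 a1) ?g"
      using total split right by (simp add: algebra_simps)
    then have "norm (2 * of_real pi * R - I n) = norm (contour_integral (linepath a1 a2) ?g
        + contour_integral (linepath a3 a4) ?g + contour_integral (linepath a4 a1) ?g)"
      by (metis mult_1 norm_ii norm_mult)
    also have "\<dots> \<le> exp (y * c) / T ^ 3 * (T + c) + exp (y * c) / T ^ 3 * (T + c) + exp (y * c) / T ^ 3 * (2 * T)"
      by (intro norm_triangle_le add_mono s1 s3 s4)
    also have "\<dots> \<le> exp (y * c) / T ^ 3 * (4 * (T + c))"
      unfolding distrib_left[symmetric] using T assms by (intro mult_left_mono) auto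
    also have "\<dots> = 4 * exp (y * c) * (T + c) / T ^ 3"
      by (simp only: times_divide_eq_left times_divide_eq_right mult_ac)
    finally show ?thesis by (simp only: T_def)
  qed
  have "(\<lambda>n. 2 * of_real pi * R - I n) \<longlonglongrightarrow> 0"
  proof (rule Lim_null_comparison)
    show "\<forall>\<^sub>F n in sequentially. norm (2 * of_real pi * R - I n) \<le> 4 * exp (y * c) * ((real n + c) / real n ^ 3)"
      using eventually_ge_at_top[of 1] by eventually_elim (use close in simp)
    have "(\<lambda>n. (real n + c) / real n ^ 3) \<longlonglongrightarrow> 0"
      by real_asymp
    then show "(\<lambda>n. 4 * exp (y * c) * ((real n + c) / real n ^ 3)) \<longlonglongrightarrow> 0"
      by (rule tendsto_mult_right_zero)
  qed
  from tendsto_diff[OF tendsto_const[of "2 * of_real pi * R"] this]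
  have "I \<longlonglongrightarrow> 2 * of_real pi * R" by simp
  from LIMSEQ_unique[OF truncated_integral_tendsto[OF int] this[unfolded I_def]]
  have "(\<integral>t. ?g (Complex c t) \<partial>lborel) = 2 * of_real pi * R" .
  then show ?thesis by (simp add: R_def)
qed

lemma perron_power:
  assumes "0 < c" "2 \<le> M"
  shows "(\<integral>t. exp (of_real y * Complex c t) / Complex c t ^ Suc M \<partial>lborel) = of_real (2 * pi * (max y 0) ^ M / fact M)"
proof (cases "0 < y")
  case True
  then show ?thesis using perron_power_pos[OF assms True] by (simp add: max_def)
next
  case False
  then have "max y 0 = 0" by simp
  then show ?thesis using perron_power_nonpos[OF assms, of y] False assms by simp
qed

subsection \<open>Riesz means of higher order\<close>

lemma finite_frequency_below:
  assumes "frequency lam"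
  shows "finite {n. lam n < x}"
proof -
  have "eventually (\<lambda>n. x \<le> lam n) sequentially"
    using assms unfolding frequency_def filterlim_at_top by blast
  then obtain N where "\<And>n. N \<le> n \<Longrightarrow> x \<le> lam n"
    by (auto simp: eventually_sequentially)
  then have "{n. lam n < x} \<subseteq> {..<N}"
    by (metis lessThan_iff linorder_not_le mem_Collect_eq subsetI)
  then show ?thesis by (rule finite_subset) simp
qed

text \<open>Convergence bounds the means only for large x. For smaller x only the finitely many
  terms below \<open>X\<close> occur, with weights in [0, 1]. The bound for all x > 0 is what the
  averaging over small arguments requires.\<close>

lemma riesz_mean_bounded:
  assumes freq: "frequency lam" and m: "0 \<le> m"
    and lim: "((\<lambda>x. riesz_mean lam m a x s) \<longlongrightarrow> L) at_top"
  shows "\<exists>D\<ge>0. \<forall>x>0. norm (riesz_mean lam m a x s) \<le> D"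
proof -
  have "eventually (\<lambda>x. dist (riesz_mean lam m a x s) L < 1) at_top"
    using lim by (rule tendstoD) simp
  then obtain X where X: "\<And>x. X \<le> x \<Longrightarrow> dist (riesz_mean lam m a x s) L < 1"
    by (auto simp: eventually_at_top_linorder)
  define S where "S = (\<Sum>n | lam n < X. norm (a n * exp (- of_real (lam n) * s)))"
  have "norm (riesz_mean lam m a x s) \<le> norm L + 1 + S" if "0 < x" for x
  proof (cases "X \<le> x")
    case True
    have "norm (riesz_mean lam m a x s) \<le> norm L + norm (riesz_mean lam m a x s - L)"
      by (rule norm_triangle_sub)
    also have "\<dots> \<le> norm L + 1"
      using X[OF True] by (simp add: dist_norm)
    finally show ?thesis
      using sum_nonneg[of "{n. lam n < X}" "\<lambda>n. norm (a n * exp (- of_real (lam n) * s))"]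
      unfolding S_def by simp
  next
    case False
    have "norm (riesz_mean lam m a x s) \<le> (\<Sum>n | lam n < x. norm (a n * exp (- of_real (lam n) * s)))"
      unfolding riesz_mean_def
    proof (rule sum_norm_le)
      fix n assume "n \<in> {n. lam n < x}"
      then have "0 \<le> 1 - lam n / x" "1 - lam n / x \<le> 1"
        using that freq by (auto simp: frequency_def field_simps)
      then have "(1 - lam n / x) powr m \<le> 1"
        using m by (intro powr_le1) auto
      then show "norm (a n * exp (- of_real (lam n) * s) * of_real ((1 - lam n / x) powr m))
          \<le> norm (a n * exp (- of_real (lam n) * s))"
        by (simp add: norm_mult mult_left_le)
    qed
    also have "\<dots> \<le> S"
      unfolding S_def using False by (intro sum_mono2 finite_frequency_below[OF freq]) auto
    finally show ?thesis by (simp add: add_increasing)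
  qed
  moreover have "0 \<le> norm L + 1 + S"
    unfolding S_def by (intro add_nonneg_nonneg sum_nonneg) auto
  ultimately show ?thesis by blast
qed

section \<open>Raising the order of a Riesz mean by Beta averages\<close>

definition beta_weight :: "real \<Rightarrow> real \<Rightarrow> real \<Rightarrow> real" where
  "beta_weight m q t = indicator {0<..<1} t * (t powr m * (1 - t) powr q)"

lemma has_bochner_integral_beta_weight:
  assumes "0 \<le> m" "0 \<le> q"
  shows "has_bochner_integral lborel (beta_weight m q) (Beta (m + 1) (q + 1))"
proof -
  have meas: "beta_weight m q \<in> borel_measurable borel"
    unfolding beta_weight_def by measurable
  have nonneg: "0 \<le> beta_weight m q t" for t
    by (simp add: beta_weight_def)
  have "((\<lambda>t. t powr m * (1 - t) powr q) has_integral Beta (m + 1) (q + 1)) {0<..<1}"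
    using has_integral_Beta_real[of "m + 1" "q + 1"] assms by (simp add: has_integral_Icc_iff_Ioo)
  then have "(beta_weight m q has_integral Beta (m + 1) (q + 1)) UNIV"
  proof (subst (asm) has_integral_restrict_UNIV[symmetric])
    have "(\<lambda>t. if t \<in> {0<..<1} then t powr m * (1 - t) powr q else 0) = beta_weight m q"
      by (auto simp: fun_eq_iff beta_weight_def indicator_def)
    then show "((\<lambda>t. if t \<in> {0<..<1} then t powr m * (1 - t) powr q else 0)
        has_integral Beta (m + 1) (q + 1)) UNIV \<Longrightarrow> (beta_weight m q has_integral Beta (m + 1) (q + 1)) UNIV"
      by simp
  qed
  then have "integral\<^sup>N lborel (beta_weight m q) = ennreal (Beta (m + 1) (q + 1))"
    using meas nonneg by (intro nn_integral_has_integral_lborel)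
  moreover have "0 \<le> Beta (m + 1) (q + 1)"
    using assms by (simp add: Beta_def)
  ultimately show ?thesis
    using meas nonneg by (intro has_bochner_integral_nn_integral) auto
qed

text \<open>The substitution \<theta> = \<mu> + (1 - \<mu>) t reduces this to the Beta integral.
  With \<mu> = lam n / x it computes the averaged weight of one term of a Riesz mean.\<close>

lemma has_bochner_integral_beta_weight_affine:
  fixes m q \<mu> :: real
  assumes "0 \<le> m" "0 \<le> q" "0 \<le> \<mu>" "\<mu> < 1"
  shows "has_bochner_integral lborel
    (\<lambda>\<theta>. indicator {\<mu><..<1} \<theta> * ((\<theta> - \<mu>) powr m * (1 - \<theta>) powr q))
    (Beta (m + 1) (q + 1) * (1 - \<mu>) powr (m + q + 1))"
proof -
  have pos: "0 < 1 - \<mu>" using assms by simp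
  have "has_bochner_integral lborel
    (\<lambda>\<theta>. beta_weight m q (- \<mu> / (1 - \<mu>) + inverse (1 - \<mu>) * \<theta>)) (Beta (m + 1) (q + 1) /\<^sub>R \<bar>inverse (1 - \<mu>)\<bar>)"
    using has_bochner_integral_beta_weight[OF assms(1,2)] pos
      lborel_has_bochner_integral_real_affine_iff[of "inverse (1 - \<mu>)" "beta_weight m q"
        "Beta (m + 1) (q + 1)" "- \<mu> / (1 - \<mu>)"] by simp
  from has_bochner_integral_mult_right[OF this, of "(1 - \<mu>) powr (m + q)"]
  have 1: "has_bochner_integral lborel
    (\<lambda>\<theta>. (1 - \<mu>) powr (m + q) * beta_weight m q (- \<mu> / (1 - \<mu>) + inverse (1 - \<mu>) * \<theta>))
    ((1 - \<mu>) powr (m + q) * (Beta (m + 1) (q + 1) * (1 - \<mu>)))"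
    using pos by (simp add: mult.commute)
  have 2: "(1 - \<mu>) powr (m + q) * beta_weight m q (- \<mu> / (1 - \<mu>) + inverse (1 - \<mu>) * \<theta>)
    = indicator {\<mu><..<1} \<theta> * ((\<theta> - \<mu>) powr m * (1 - \<theta>) powr q)" for \<theta>
  proof -
    have e: "- \<mu> / (1 - \<mu>) + inverse (1 - \<mu>) * \<theta> = (\<theta> - \<mu>) / (1 - \<mu>)"
      unfolding diff_divide_distrib by (simp add: divide_inverse mult.commute)
    have e': "1 - (\<theta> - \<mu>) / (1 - \<mu>) = (1 - \<theta>) / (1 - \<mu>)"
      using pos by (simp add: field_simps)
    have ind: "indicator {0<..<1} ((\<theta> - \<mu>) / (1 - \<mu>)) = (indicator {\<mu><..<1} \<theta> :: real)"
      using pos by (auto simp: indicator_def field_simps)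
    show ?thesis
    proof (cases "\<theta> \<in> {\<mu><..<1}")
      case True
      then have "((\<theta> - \<mu>) / (1 - \<mu>)) powr m * ((1 - \<theta>) / (1 - \<mu>)) powr q
          = (\<theta> - \<mu>) powr m * (1 - \<theta>) powr q / (1 - \<mu>) powr (m + q)"
        using pos by (simp add: powr_divide powr_add)
      then show ?thesis
        unfolding beta_weight_def e e' ind using pos by simp
    next
      case False
      then show ?thesis unfolding beta_weight_def e ind by simp
    qed
  qed
  have 3: "(1 - \<mu>) powr (m + q) * (Beta (m + 1) (q + 1) * (1 - \<mu>))
      = Beta (m + 1) (q + 1) * (1 - \<mu>) powr (m + q + 1)"
    using pos by (simp add: powr_add)
  show ?thesis using 1 unfolding 2 3 .
qed

text \<open>Riesz's consistency argument: \<theta>^m (1 - \<mu>/\<theta>)^m = (\<theta> - \<mu>)^m,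
  so averaging the order-m means at \<theta> x against the Beta weight gives, term by term, a
  multiple of the mean of order m + q + 1 at x.\<close>

lemma riesz_mean_average:
  assumes freq: "frequency lam" and "0 \<le> m" "0 \<le> q" "0 < x"
  shows "has_bochner_integral lborel
    (\<lambda>\<theta>. of_real (beta_weight m q \<theta>) * riesz_mean lam m a (\<theta> * x) s)
    (of_real (Beta (m + 1) (q + 1)) * riesz_mean lam (m + q + 1) a x s)"
proof -
  define c where "c n = a n * exp (- of_real (lam n) * s)" for n
  have fin: "finite {n. lam n < x}"
    by (rule finite_frequency_below[OF freq])
  have "has_bochner_integral lborel
      (\<lambda>\<theta>. \<Sum>n | lam n < x. c n * of_real (indicator {lam n / x<..<1} \<theta> * ((\<theta> - lam n / x) powr m * (1 - \<theta>) powr q)))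
      (\<Sum>n | lam n < x. c n * of_real (Beta (m + 1) (q + 1) * (1 - lam n / x) powr (m + q + 1)))"
    using assms
    by (intro has_bochner_integral_sum has_bochner_integral_mult_right has_bochner_integral_of_real
        has_bochner_integral_beta_weight_affine) (auto simp: frequency_def)
  moreover have "(\<Sum>n | lam n < x. c n * of_real (indicator {lam n / x<..<1} \<theta> * ((\<theta> - lam n / x) powr m * (1 - \<theta>) powr q)))
      = of_real (beta_weight m q \<theta>) * riesz_mean lam m a (\<theta> * x) s" for \<theta>
  proof (cases "\<theta> \<in> {0<..<1}")
    case True
    then have "\<theta> * x < x"
      using assms(4) by simp
    then have sub: "{n. lam n < \<theta> * x} \<subseteq> {n. lam n < x}"
      by auto
    have "(\<Sum>n | lam n < x. c n * of_real (indicator {lam n / x<..<1} \<theta> * ((\<theta> - lam n / x) powr m * (1 - \<theta>) powr q)))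
      = (\<Sum>n | lam n < \<theta> * x. c n * of_real (indicator {lam n / x<..<1} \<theta> * ((\<theta> - lam n / x) powr m * (1 - \<theta>) powr q)))"
      using assms(4) by (intro sum.mono_neutral_right fin sub) (auto simp: indicator_def field_simps)
    also have "\<dots> = (\<Sum>n | lam n < \<theta> * x. of_real (beta_weight m q \<theta>) * (c n * of_real ((1 - lam n / (\<theta> * x)) powr m)))"
    proof (rule sum.cong)
      fix n assume n: "n \<in> {n. lam n < \<theta> * x}"
      have "\<theta> - lam n / x = \<theta> * (1 - lam n / (\<theta> * x))"
        using True assms(4) by (simp add: field_simps)
      moreover have "0 \<le> 1 - lam n / (\<theta> * x)"
        using n True assms(4) by (simp add: field_simps)
      ultimately have "(\<theta> - lam n / x) powr m = \<theta> powr m * (1 - lam n / (\<theta> * x)) powr m"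
        using True by (simp add: powr_mult)
      moreover have "indicator {lam n / x<..<1} \<theta> = (1::real)"
        using n True assms(4) by (simp add: field_simps)
      ultimately show "c n * of_real (indicator {lam n / x<..<1} \<theta> * ((\<theta> - lam n / x) powr m * (1 - \<theta>) powr q))
          = of_real (beta_weight m q \<theta>) * (c n * of_real ((1 - lam n / (\<theta> * x)) powr m))"
        using True by (simp add: beta_weight_def)
    qed simp
    finally show ?thesis
      by (simp add: riesz_mean_def c_def sum_distrib_left)
  next
    case False
    have "indicator {lam n / x<..<1} \<theta> = (0::real)" for n
    proof -
      have "0 \<le> lam n / x" using assms by (simp add: frequency_def)
      then show ?thesis using False by (auto simp: indicator_def)
    qed
    then show ?thesis using False by (simp add: beta_weight_def)
  qed
  moreover have "(\<Sum>n | lam n < x. c n * of_real (Beta (m + 1) (q + 1) * (1 - lam n / x) powr (m + q + 1)))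
      = of_real (Beta (m + 1) (q + 1)) * riesz_mean lam (m + q + 1) a x s"
    by (simp add: riesz_mean_def c_def sum_distrib_left mult_ac)
  ultimately show ?thesis by simp
qed

text \<open>Replaces the real order of a germ by an integer order, for which Taylor's and Perron's
  formulas are available. A higher mean is a weighted average of lower ones, so dominated
  convergence keeps the limit; m + 1 \<le> K makes the second Beta exponent \<open>q\<close>
  nonnegative.\<close>

lemma riesz_mean_tendsto_higher_order:
  assumes freq: "frequency lam" and m: "0 \<le> m" "m + 1 \<le> K"
    and lim: "((\<lambda>x. riesz_mean lam m a x s) \<longlongrightarrow> L) at_top"
  shows "((\<lambda>x. riesz_mean lam K a x s) \<longlongrightarrow> L) at_top"
proof -
  define q where "q = K - m - 1"
  have q: "0 \<le> q" "m + q + 1 = K" using m by (auto simp: q_def)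
  define \<beta> where "\<beta> = Beta (m + 1) (q + 1)"
  have "0 < \<beta>" unfolding \<beta>_def Beta_def using m q by (simp add: Gamma_real_pos)
  obtain D where D: "\<And>x. 0 < x \<Longrightarrow> norm (riesz_mean lam m a x s) \<le> D"
    using riesz_mean_bounded[OF freq m(1) lim] by blast
  let ?h = "\<lambda>x \<theta>. of_real (beta_weight m q \<theta>) * riesz_mean lam m a (\<theta> * x) s"
  note wt = has_bochner_integral_beta_weight[OF m(1) q(1)]
  note avg = riesz_mean_average[OF freq m(1) q(1), of _ a s]
  \<comment> \<open>The case distinction on 0 < x makes the integrand measurable and dominated for
    every real x, while the averaging identity holds only for positive x.\<close>
  have lim1: "((\<lambda>x. \<integral>\<theta>. (if 0 < x then ?h x \<theta> else 0) \<partial>lborel) \<longlongrightarrow> (\<integral>\<theta>. of_real (beta_weight m q \<theta>) * L \<partial>lborel)) at_top"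
  proof (rule integral_dominated_convergence_at_top[where w = "\<lambda>\<theta>. beta_weight m q \<theta> * D"])
    show "(\<lambda>\<theta>. complex_of_real (beta_weight m q \<theta>) * L) \<in> borel_measurable lborel"
      using borel_measurable_has_bochner_integral[OF wt] by measurable
    show "(\<lambda>\<theta>. if 0 < x then ?h x \<theta> else 0) \<in> borel_measurable lborel" for x
      using borel_measurable_has_bochner_integral[OF avg[of x]] by (cases "0 < x") auto
    show "integrable lborel (\<lambda>\<theta>. beta_weight m q \<theta> * D)"
      using wt by (auto dest: integrable.intros)
    show "\<forall>\<^sub>F x in at_top. AE \<theta> in lborel. norm (if 0 < x then ?h x \<theta> else 0) \<le> beta_weight m q \<theta> * D"
    proof (intro always_eventually allI AE_I2)
      fix x \<theta> :: real
      have D0: "0 \<le> D" using D[of 1] norm_ge_zero order_trans by (metis zero_less_one)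
      show "norm (if 0 < x then ?h x \<theta> else 0) \<le> beta_weight m q \<theta> * D"
      proof (cases "\<theta> \<in> {0<..<1} \<and> 0 < x")
        case True
        then have "norm (riesz_mean lam m a (\<theta> * x) s) \<le> D"
          by (intro D) auto
        then show ?thesis using True
          by (auto simp: norm_mult beta_weight_def intro!: mult_left_mono)
      qed (use D0 in \<open>auto simp: beta_weight_def\<close>)
    qed
    show "AE \<theta> in lborel. ((\<lambda>x. if 0 < x then ?h x \<theta> else 0) \<longlongrightarrow> of_real (beta_weight m q \<theta>) * L) at_top"
    proof (intro AE_I2)
      fix \<theta> :: real
      have "((\<lambda>x. ?h x \<theta>) \<longlongrightarrow> of_real (beta_weight m q \<theta>) * L) at_top"
      proof (cases "0 < \<theta>")
        case True
        then have "filterlim (\<lambda>x. \<theta> * x) at_top at_top"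
          by real_asymp
        then show ?thesis
          by (intro tendsto_mult tendsto_const filterlim_compose[OF lim])
      qed (simp add: beta_weight_def)
      then show "((\<lambda>x. if 0 < x then ?h x \<theta> else 0) \<longlongrightarrow> of_real (beta_weight m q \<theta>) * L) at_top"
        by (rule Lim_transform_eventually) (use eventually_gt_at_top[of 0] in eventually_elim, simp)
    qed
  qed
  have eq: "(\<integral>\<theta>. of_real (beta_weight m q \<theta>) * L \<partial>lborel) = of_real \<beta> * L"
    using has_bochner_integral_integral_eq[OF has_bochner_integral_mult_left[OF has_bochner_integral_of_real[OF wt]], of L]
    by (simp add: \<beta>_def)
  have ev: "eventually (\<lambda>x. (\<integral>\<theta>. (if 0 < x then ?h x \<theta> else 0) \<partial>lborel) = of_real \<beta> * riesz_mean lam K a x s) at_top"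
    using eventually_gt_at_top[of 0]
  proof eventually_elim
    case (elim x)
    then show ?case
      using has_bochner_integral_integral_eq[OF avg[OF elim]] q by (simp add: \<beta>_def)
  qed
  have "((\<lambda>x. of_real \<beta> * riesz_mean lam K a x s) \<longlongrightarrow> of_real \<beta> * L) at_top"
    by (rule Lim_transform_eventually[OF lim1[unfolded eq] ev])
  from tendsto_mult[OF tendsto_const[of "inverse (complex_of_real \<beta>)"] this] show ?thesis
    using \<open>0 < \<beta>\<close> by (simp flip: mult.assoc)
qed

subsection \<open>Growth of Riesz means on vertical lines\<close>

text \<open>The unnormalised Riesz mean at s = 0: the variable s is absorbed into the coefficients,
  and no division by y^k disturbs the differentiation in y.\<close>

definition riesz_sum :: "(nat \<Rightarrow> real) \<Rightarrow> nat \<Rightarrow> (nat \<Rightarrow> complex) \<Rightarrow> real \<Rightarrow> complex" where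
  "riesz_sum lam k a y = (\<Sum>n | lam n < y. a n * of_real ((y - lam n) ^ k))"

lemma riesz_mean_eq_riesz_sum:
  assumes "0 < x"
  shows "riesz_mean lam (real k) a x s = riesz_sum lam k (\<lambda>n. a n * exp (- of_real (lam n) * s)) x / of_real (x ^ k)"
  unfolding riesz_mean_def riesz_sum_def sum_divide_distrib
proof (rule sum.cong)
  fix n assume "n \<in> {n. lam n < x}"
  then have "(1 - lam n / x) powr real k = (1 - lam n / x) ^ k"
    using assms by (simp add: powr_realpow)
  also have "\<dots> = (x - lam n) ^ k / x ^ k"
    using assms by (simp add: power_divide[symmetric] diff_divide_distrib)
  finally show "a n * exp (- of_real (lam n) * s) * of_real ((1 - lam n / x) powr real k)
      = a n * exp (- of_real (lam n) * s) * of_real ((x - lam n) ^ k) / of_real (x ^ k)"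
    by simp
qed simp

text \<open>Truncated powers allow one finite index set for all y \<le> x, so sums at different y
  can be subtracted or integrated term by term.\<close>

lemma riesz_sum_eq_positive_part:
  assumes "frequency lam" "y \<le> x" "0 < k"
  shows "riesz_sum lam k a y = (\<Sum>n | lam n < x. a n * of_real ((max (y - lam n) 0) ^ k))"
  unfolding riesz_sum_def
proof (rule sum.mono_neutral_cong_left)
  show "finite {n. lam n < x}"
    by (rule finite_frequency_below[OF assms(1)])
qed (use assms in \<open>auto simp: max_def\<close>)

section \<open>Derivatives and Taylor remainder of exp (z w) w^K\<close>

lemma higher_deriv_exp_times_power:
  fixes z w :: complex
  shows "(deriv ^^ n) (\<lambda>w. exp (z * w) * w ^ K) w =
    (\<Sum>i = 0..n. of_nat (n choose i) * (z ^ i * exp (z * w)) *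
      (pochhammer (of_nat (Suc K - (n - i))) (n - i) * w ^ (K - (n - i))))"
proof -
  have 1: "(deriv ^^ i) (\<lambda>w. exp (z * w)) w = z ^ i * exp (z * w)" for i
  proof -
    have "(deriv ^^ i) exp = (exp :: complex \<Rightarrow> complex)"
    proof (induction i)
      case (Suc i)
      moreover have "deriv exp = (exp :: complex \<Rightarrow> complex)"
        by (intro ext DERIV_imp_deriv DERIV_exp)
      ultimately show ?case by simp
    qed simp
    then show ?thesis
      using higher_deriv_compose_linear[of exp UNIV UNIV w z i] by (simp add: holomorphic_intros)
  qed
  have 2: "(deriv ^^ i) (\<lambda>w::complex. w ^ K) w = pochhammer (of_nat (Suc K - i)) i * w ^ (K - i)" for i
    using higher_deriv_power[where z = 0 and n = K and j = i and w = w] by simp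
  show ?thesis
    by (subst higher_deriv_mult[of _ UNIV]) (auto intro!: holomorphic_intros simp: 1 2)
qed

text \<open>The factor w^K is there to kill the derivatives of order below K at 0. The Taylor
  polynomial is then just r^K, and the remainder involves K-th powers only, which are the terms of
  Riesz sums of the same order.\<close>

lemma exp_times_power_taylor:
  fixes z :: complex
  assumes "0 \<le> r"
  shows "((\<lambda>t. of_real ((r - t) ^ K / fact K) * (deriv ^^ Suc K) (\<lambda>w. exp (z * w) * w ^ K) (of_real t))
    has_integral (exp (z * of_real r) * of_real r ^ K - of_real r ^ K)) {0..r}"
proof -
  let ?F = "\<lambda>w. exp (z * w) * w ^ K"
  let ?D = "\<lambda>i t. (deriv ^^ i) ?F (complex_of_real t)"
  have holo: "?F holomorphic_on UNIV"
    by (intro holomorphic_intros)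
  have D: "(?D i has_vector_derivative ?D (Suc i) t) (at t within {0..r})" for i t
  proof (rule has_vector_derivative_real_field)
    have "(deriv ^^ i) ?F field_differentiable (at (of_real t))"
      using holomorphic_higher_deriv[OF holo open_UNIV, of i] holomorphic_on_imp_differentiable_at by blast
    then show "((deriv ^^ i) ?F has_field_derivative ?D (Suc i) t) (at (of_real t))"
      by (simp add: field_differentiable_derivI)
  qed
  have low: "?D i 0 = 0" if "i < K" for i
    unfolding higher_deriv_exp_times_power using that by (intro sum.neutral) auto
  have top: "?D K 0 = fact K"
  proof -
    have "?D K 0 = (\<Sum>i = 0..K. if i = 0 then fact K else 0)"
      unfolding higher_deriv_exp_times_power
      by (intro sum.cong) (auto simp: pochhammer_fact)
    then show ?thesis by simp
  qed
  have "((\<lambda>t. ((r - t) ^ (Suc K - 1) / fact (Suc K - 1)) *\<^sub>R ?D (Suc K) t) has_integral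
      (?F (of_real r) - (\<Sum>i<Suc K. ((r - 0) ^ i / fact i) *\<^sub>R ?D i 0))) {0..r}"
    by (rule Taylor_has_integral[where f = "\<lambda>t. ?F (of_real t)" and Df = ?D]) (use D assms in auto)
  moreover have "(\<Sum>i<Suc K. ((r - 0) ^ i / fact i) *\<^sub>R ?D i 0) = of_real r ^ K"
    using low top by (simp add: scaleR_conv_of_real)
  ultimately show ?thesis
    by (simp add: scaleR_conv_of_real del: funpow.simps)
qed

text \<open>In Leibniz' formula a derivative falling on the exponential costs |z|, one falling on
  the power costs at most K; the binomial theorem collects them. What matters is polynomial growth
  in z.\<close>

lemma norm_higher_deriv_exp_times_power_le:
  fixes z w :: complex
  assumes "norm w \<le> x" "1 \<le> x"
  shows "norm ((deriv ^^ n) (\<lambda>w. exp (z * w) * w ^ K) w) \<le> norm (exp (z * w)) * x ^ K * (norm z + real K) ^ n"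
proof -
  have poch: "norm (pochhammer (of_nat (Suc K - j)) j * w ^ (K - j) :: complex) \<le> real K ^ j * x ^ K" for j
  proof (cases "j \<le> K")
    case True
    have "norm (pochhammer (of_nat (Suc K - j)) j :: complex) = (\<Prod>l<j. norm (of_nat (Suc K - j + l) :: complex))"
      by (simp only: pochhammer_prod prod_norm lessThan_atLeast0 of_nat_add)
    also have "\<dots> \<le> (\<Prod>l<j. real K)"
      unfolding norm_of_nat using True by (intro prod_mono) auto
    also have "\<dots> = real K ^ j" by simp
    finally have "norm (pochhammer (of_nat (Suc K - j)) j :: complex) \<le> real K ^ j" .
    moreover have "norm (w ^ (K - j)) \<le> x ^ K"
    proof -
      have "norm w ^ (K - j) \<le> x ^ (K - j)" using assms by (intro power_mono) auto
      also have "\<dots> \<le> x ^ K" using assms by (intro power_increasing) auto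
      finally show ?thesis by (simp add: norm_power)
    qed
    ultimately show ?thesis
      unfolding norm_mult by (intro mult_mono) auto
  next
    case False
    \<comment> \<open>Truncated subtraction gives the right value: for j > K the base is 0, matching
      a derivative of w^K that vanishes.\<close>
    then have "pochhammer (of_nat (Suc K - j)) j = (0 :: complex)"
      by (simp add: pochhammer_0_left)
    then show ?thesis using assms by simp
  qed
  have "norm ((deriv ^^ n) (\<lambda>w. exp (z * w) * w ^ K) w) \<le>
    (\<Sum>i = 0..n. of_nat (n choose i) * (norm z ^ i * norm (exp (z * w))) * (real K ^ (n - i) * x ^ K))"
    unfolding higher_deriv_exp_times_power
  proof (rule sum_norm_le)
    fix i
    show "norm (of_nat (n choose i) * (z ^ i * exp (z * w)) *
      (pochhammer (of_nat (Suc K - (n - i))) (n - i) * w ^ (K - (n - i))))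
      \<le> of_nat (n choose i) * (norm z ^ i * norm (exp (z * w))) * (real K ^ (n - i) * x ^ K)"
      unfolding norm_mult[of "of_nat _ * _"]
      using poch[of "n - i"] by (intro mult_mono) (auto simp: norm_mult norm_power)
  qed
  also have "\<dots> = norm (exp (z * w)) * x ^ K * (\<Sum>i\<le>n. of_nat (n choose i) * norm z ^ i * real K ^ (n - i))"
    by (simp add: sum_distrib_left atMost_atLeast0 mult_ac)
  also have "\<dots> = norm (exp (z * w)) * x ^ K * (norm z + real K) ^ n"
    by (simp add: binomial_ring)
  finally show ?thesis .
qed

lemma exp_times_power_positive_part:
  fixes z :: complex
  assumes "0 \<le> r" "r \<le> x" "0 < K"
  shows "((\<lambda>t. of_real ((max (r - t) 0) ^ K / fact K) * (deriv ^^ Suc K) (\<lambda>w. exp (z * w) * w ^ K) (of_real t))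
    has_integral (exp (z * of_real r) * of_real r ^ K - of_real r ^ K)) {0..x}"
proof -
  let ?f = "\<lambda>t. of_real ((max (r - t) 0) ^ K / fact K) * (deriv ^^ Suc K) (\<lambda>w. exp (z * w) * w ^ K) (of_real t)"
  have 1: "(?f has_integral (exp (z * of_real r) * of_real r ^ K - of_real r ^ K)) {0..r}"
    by (rule has_integral_eq[OF _ exp_times_power_taylor[OF assms(1)]]) (auto simp: max_def)
  have 2: "(?f has_integral 0) {r..x}"
    by (rule has_integral_eq[OF _ has_integral_0]) (use assms in \<open>auto simp: max_def\<close>)
  show ?thesis
    using has_integral_combine[OF assms(1,2) 1 2] by simp
qed

text \<open>The bound is uniform in x. With v = (x - t) / 2, the exponential series gives v^K / K!
  \<le> exp v; this costs a factor 2^K and half of the decay, and the remaining half integrates to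
  at most 2.\<close>

lemma integral_power_times_exp_le:
  fixes x :: real
  assumes "0 \<le> x"
  shows "(\<lambda>t. (x - t) ^ K / fact K * exp (- (x - t))) integrable_on {0..x}"
    and "integral {0..x} (\<lambda>t. (x - t) ^ K / fact K * exp (- (x - t))) \<le> 2 ^ Suc K"
proof -
  show int: "(\<lambda>t. (x - t) ^ K / fact K * exp (- (x - t))) integrable_on {0..x}"
    by (intro integrable_continuous_real continuous_intros) auto
  have "((\<lambda>t. 2 ^ K * exp ((t - x) / 2)) has_integral (2 ^ Suc K * exp ((x - x) / 2) - 2 ^ Suc K * exp ((0 - x) / 2))) {0..x}"
    using assms by (intro fundamental_theorem_of_calculus)
      (auto intro!: derivative_eq_intros simp flip: has_real_derivative_iff_has_vector_derivative)
  then have hi: "((\<lambda>t. 2 ^ K * exp ((t - x) / 2)) has_integral (2 ^ Suc K - 2 ^ Suc K * exp (- x / 2))) {0..x}"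
    by simp
  have "integral {0..x} (\<lambda>t. (x - t) ^ K / fact K * exp (- (x - t))) \<le> integral {0..x} (\<lambda>t. 2 ^ K * exp ((t - x) / 2))"
  proof (rule integral_le[OF int])
    show "(\<lambda>t. 2 ^ K * exp ((t - x) / 2)) integrable_on {0..x}"
      using hi by blast
    fix t assume t: "t \<in> {0..x}"
    define v where "v = (x - t) / 2"
    have "0 \<le> v" using t by (simp add: v_def)
    have "v ^ K / fact K \<le> exp v"
    proof -
      have "v ^ K / fact K \<le> (\<Sum>i<Suc K. v ^ i / fact i)"
        using \<open>0 \<le> v\<close> by (simp add: sum_nonneg)
      also have "\<dots> \<le> exp v"
      proof -
        have "(\<Sum>i<Suc K. inverse (fact i) * v ^ i) \<le> (\<Sum>i. inverse (fact i) * v ^ i)"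
          using \<open>0 \<le> v\<close> summable_exp[of v] by (intro sum_le_suminf) auto
        also have "\<dots> = exp v" by (simp add: exp_def scaleR_conv_of_real)
        finally show ?thesis by (simp add: divide_inverse mult.commute)
      qed
      finally show ?thesis .
    qed
    then have "2 ^ K * (v ^ K / fact K) * exp (- 2 * v) \<le> 2 ^ K * exp v * exp (- 2 * v)"
      by (intro mult_right_mono mult_left_mono) auto
    also have "\<dots> = 2 ^ K * exp (- v)" by (simp add: mult.assoc flip: exp_add)
    also have "2 ^ K * (v ^ K / fact K) * exp (- 2 * v) = (x - t) ^ K / fact K * exp (- (x - t))"
      by (simp add: v_def power_divide)
    also have "2 ^ K * exp (- v) = 2 ^ K * exp ((t - x) / 2)"
      by (simp add: v_def field_simps)
    finally show "(x - t) ^ K / fact K * exp (- (x - t)) \<le> 2 ^ K * exp ((t - x) / 2)" .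
  qed
  also have "\<dots> = 2 ^ Suc K - 2 ^ Suc K * exp (- x / 2)"
    using hi by (rule integral_unique)
  also have "\<dots> \<le> 2 ^ Suc K" by simp
  finally show "integral {0..x} (\<lambda>t. (x - t) ^ K / fact K * exp (- (x - t))) \<le> 2 ^ Suc K" .
qed

text \<open>The integral form of Taylor's theorem, applied to each summand in the variable x - lam n, transfers a bound
  on the Riesz sums at one point to a polynomial bound on the Riesz means along a vertical line.\<close>

lemma riesz_mean_exp_twist:
  assumes freq: "frequency lam" and K: "0 < K" and x: "0 < x"
  shows "((\<lambda>t. riesz_sum lam K b (x - t) / fact K * (deriv ^^ Suc K) (\<lambda>w. exp (z * w) * w ^ K) (of_real t))
    has_integral (exp (z * of_real x) * of_real (x ^ K) * riesz_mean lam (real K) b x z - riesz_sum lam K b x)) {0..x}"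
proof -
  let ?D = "\<lambda>t. (deriv ^^ Suc K) (\<lambda>w. exp (z * w) * w ^ K) (of_real t)"
  let ?r = "\<lambda>n. x - lam n"
  have "((\<lambda>t. \<Sum>n | lam n < x. b n * (of_real ((max (?r n - t) 0) ^ K / fact K) * ?D t)) has_integral
    (\<Sum>n | lam n < x. b n * (exp (z * of_real (?r n)) * of_real (?r n) ^ K - of_real (?r n) ^ K))) {0..x}"
    using freq K
    by (intro has_integral_sum finite_frequency_below[OF freq] has_integral_mult_right exp_times_power_positive_part)
      (auto simp: frequency_def)
  moreover have "(\<Sum>n | lam n < x. b n * (of_real ((max (?r n - t) 0) ^ K / fact K) * ?D t))
      = riesz_sum lam K b (x - t) / fact K * ?D t" if "t \<in> {0..x}" for t
  proof -
    have "riesz_sum lam K b (x - t) = (\<Sum>n | lam n < x. b n * of_real ((max (?r n - t) 0) ^ K))"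
      using riesz_sum_eq_positive_part[OF freq, of "x - t" x K b] that K by (simp add: algebra_simps)
    then show ?thesis
      by (simp add: sum_distrib_right sum_divide_distrib mult.assoc)
  qed
  moreover have "(\<Sum>n | lam n < x. b n * (exp (z * of_real (?r n)) * of_real (?r n) ^ K - of_real (?r n) ^ K))
      = exp (z * of_real x) * of_real (x ^ K) * riesz_mean lam (real K) b x z - riesz_sum lam K b x"
  proof -
    have "of_real (x ^ K) * riesz_mean lam (real K) b x z = riesz_sum lam K (\<lambda>n. b n * exp (- of_real (lam n) * z)) x"
      using riesz_mean_eq_riesz_sum[OF x] x by simp
    then have "exp (z * of_real x) * of_real (x ^ K) * riesz_mean lam (real K) b x z
        = (\<Sum>n | lam n < x. exp (z * of_real x) * (b n * exp (- of_real (lam n) * z) * of_real (?r n ^ K)))"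
      by (simp add: riesz_sum_def sum_distrib_left mult.assoc)
    also have "\<dots> = (\<Sum>n | lam n < x. b n * (exp (z * of_real (?r n)) * of_real (?r n) ^ K))"
      by (intro sum.cong) (auto simp: right_diff_distrib exp_diff exp_minus field_simps)
    finally show ?thesis
      by (simp add: riesz_sum_def sum_subtractf right_diff_distrib)
  qed
  ultimately show ?thesis
    by (simp only:) (rule has_integral_eq)
qed

text \<open>In the Taylor identity, |exp (z t)| = exp x * exp (-(x - t)) on Re z = 1. The factor exp
  x * x^K cancels upon solving for the mean, and the rest integrates to a bound independent of x.
  This is the majorant for letting x tend to infinity under Perron's integral.\<close>

lemma riesz_mean_vertical_growth:
  assumes freq: "frequency lam" and K: "0 < K"
    and C: "\<And>t. 0 < t \<Longrightarrow> norm (riesz_sum lam K b t) \<le> C * t ^ K"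
    and x: "1 \<le> x" and z: "Re z = 1"
  shows "norm (riesz_mean lam (real K) b x z) \<le> C * (1 + 2 ^ Suc K) * (norm z + real K) ^ Suc K"
proof -
  let ?D = "\<lambda>t. (deriv ^^ Suc K) (\<lambda>w. exp (z * w) * w ^ K) (complex_of_real t)"
  let ?N = "(norm z + real K) ^ Suc K"
  let ?J = "exp (z * of_real x) * of_real (x ^ K) * riesz_mean lam (real K) b x z"
  have C0: "0 \<le> C" using order_trans[OF norm_ge_zero C[of 1]] by simp
  \<comment> \<open>The endpoint t = 0 occurs in the integral over [0, x]; the sum is empty there
    because the frequency is nonnegative.\<close>
  have C': "norm (riesz_sum lam K b t) \<le> C * t ^ K" if "0 \<le> t" for t
  proof (cases "t = 0")
    case True
    have "{n. lam n < 0} = {}" using freq by (auto simp: frequency_def not_less)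
    then show ?thesis using True K by (simp add: riesz_sum_def power_0_left)
  qed (use C that in auto)
  have "1 \<le> norm z" using complex_Re_le_cmod[of z] z by simp
  then have N1: "1 \<le> ?N" by (intro one_le_power) simp
  note hi = riesz_mean_exp_twist[OF freq K, of x b z]
  have int: "norm (integral {0..x} (\<lambda>t. riesz_sum lam K b (x - t) / fact K * ?D t))
      \<le> integral {0..x} (\<lambda>t. C * ?N * x ^ K * exp x * ((x - t) ^ K / fact K * exp (- (x - t))))"
  proof (rule Henstock_Kurzweil_Integration.integral_norm_bound_integral)
    show "(\<lambda>t. riesz_sum lam K b (x - t) / fact K * ?D t) integrable_on {0..x}"
      using hi x by auto
    show "(\<lambda>t. C * ?N * x ^ K * exp x * ((x - t) ^ K / fact K * exp (- (x - t)))) integrable_on {0..x}"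
      using x by (intro integrable_on_mult_right integral_power_times_exp_le) auto
    fix t assume t: "t \<in> {0..x}"
    have "norm (riesz_sum lam K b (x - t) / fact K * ?D t)
        \<le> (C * (x - t) ^ K / fact K) * (exp t * x ^ K * ?N)"
    proof -
      have "norm (?D t) \<le> exp t * x ^ K * ?N"
        using norm_higher_deriv_exp_times_power_le[of "of_real t" x "Suc K" z K] t x z by simp
      moreover have "norm (riesz_sum lam K b (x - t) / fact K) \<le> C * (x - t) ^ K / fact K"
        using C'[of "x - t"] t by (simp add: norm_divide divide_right_mono)
      ultimately show ?thesis
        unfolding norm_mult using C0 t by (intro mult_mono) auto
    qed
    also have "exp t = exp x * exp (- (x - t))"
      by (simp flip: exp_add)
    finally show "norm (riesz_sum lam K b (x - t) / fact K * ?D t)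
        \<le> C * ?N * x ^ K * exp x * ((x - t) ^ K / fact K * exp (- (x - t)))"
      by (simp add: mult_ac)
  qed
  have "norm (?J - riesz_sum lam K b x) \<le> C * ?N * x ^ K * exp x * 2 ^ Suc K"
  proof -
    have "?J - riesz_sum lam K b x = integral {0..x} (\<lambda>t. riesz_sum lam K b (x - t) / fact K * ?D t)"
      using integral_unique[OF hi] x by simp
    also have "norm \<dots> \<le> C * ?N * x ^ K * exp x * integral {0..x} (\<lambda>t. (x - t) ^ K / fact K * exp (- (x - t)))"
      using int by simp
    also have "\<dots> \<le> C * ?N * x ^ K * exp x * 2 ^ Suc K"
      using C0 x by (intro mult_left_mono integral_power_times_exp_le) auto
    finally show ?thesis .
  qed
  moreover have "norm (riesz_sum lam K b x) \<le> C * ?N * x ^ K * exp x"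
  proof -
    have "C * x ^ K * 1 \<le> C * x ^ K * (?N * exp x)"
      using N1 x C0 mult_mono[OF N1, of 1 "exp x"] by (intro mult_left_mono) auto
    then show ?thesis using C[of x] x by (simp add: mult_ac)
  qed
  ultimately have "norm ?J \<le> C * ?N * x ^ K * exp x * 2 ^ Suc K + C * ?N * x ^ K * exp x"
    using norm_triangle_sub[of ?J "riesz_sum lam K b x"] by linarith
  also have "\<dots> = exp x * x ^ K * (C * (1 + 2 ^ Suc K) * ?N)"
    by (simp add: algebra_simps)
  finally have "exp x * x ^ K * norm (riesz_mean lam (real K) b x z) \<le> exp x * x ^ K * (C * (1 + 2 ^ Suc K) * ?N)"
    using x z by (simp add: norm_mult norm_power)
  then show ?thesis
    using x by (subst (asm) mult_le_cancel_left_pos) auto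
qed

subsection \<open>Perron's formula\<close>

text \<open>The growth of v uses up p of the n powers; the remaining n - p \<ge> 2 go to
  \<open>inverse_power_bound\<close>.\<close>

lemma perron_kernel_bound:
  assumes c: "0 < c" "c \<le> Re w" and v: "norm v \<le> E * norm w ^ p" and n: "p + 2 \<le> n"
  shows "norm (v * exp (of_real y * w) / w ^ n) \<le>
    (E * exp (y * Re w) / (c ^ (n - p - 2) * min 1 (c\<^sup>2))) / (1 + (Im w)\<^sup>2)"
proof -
  have w: "0 < norm w"
    using c by auto
  have "0 \<le> E * norm w ^ p"
    using v norm_ge_zero order_trans by blast
  \<comment> \<open>The sign of \<open>E\<close> is forced by the bound on v, since |w| > 0.\<close>
  then have E: "0 \<le> E"
    using mult_neg_pos[of E "norm w ^ p"] w by (metis not_le zero_less_power)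
  have "norm (v * exp (of_real y * w) / w ^ n) = norm v * exp (y * Re w) / norm w ^ n"
    by (simp add: norm_mult norm_divide norm_power)
  also have "\<dots> \<le> E * norm w ^ p * exp (y * Re w) / norm w ^ n"
    using v by (intro divide_right_mono mult_right_mono) auto
  also have "norm w ^ n = norm w ^ p * norm w ^ (n - p)"
    using n by (simp flip: power_add)
  also have "E * norm w ^ p * exp (y * Re w) / (norm w ^ p * norm w ^ (n - p)) = E * exp (y * Re w) * (1 / norm w ^ (n - p))"
    using w by simp
  also have "\<dots> \<le> E * exp (y * Re w) * ((1 / (c ^ (n - p - 2) * min 1 (c\<^sup>2))) / (1 + (Im w)\<^sup>2))"
    using E inverse_power_bound[OF c, of "n - p"] n by (intro mult_left_mono) auto
  finally show ?thesis by simp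
qed

lemma perron_kernel_continuous:
  assumes "continuous_on (half_plane 0) g"
  shows "continuous_on (half_plane 0) (\<lambda>w. g w * exp (of_real y * w) / w ^ n)"
  using assms by (intro continuous_intros) auto

lemma perron_kernel_integrable:
  assumes "continuous_on (half_plane 0) g" "0 < c" "p + 2 \<le> n"
    and "\<And>t. norm (g (Complex c t)) \<le> E * norm (Complex c t) ^ p"
  shows "integrable lborel (\<lambda>t. g (Complex c t) * exp (of_real y * Complex c t) / Complex c t ^ n)"
  using perron_kernel_bound[of c "Complex c _" "g (Complex c _)" E p n y] assms
  by (intro integrable_vertical_line[where g = "\<lambda>w. g w * exp (of_real y * w) / w ^ n"
        and B = "E * exp (y * c) / (c ^ (n - p - 2) * min 1 (c\<^sup>2))"]
      perron_kernel_continuous) auto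

lemma riesz_mean_translate:
  "riesz_mean lam m a x (u + s) = riesz_mean lam m (\<lambda>n. a n * exp (- of_real (lam n) * u)) x s"
  unfolding riesz_mean_def by (intro sum.cong) (simp_all only: distrib_left distrib_right exp_add mult_ac)

text \<open>A finite sum, so Perron's formula holds term by term: the factor exp (- lam n * w)
  merely shifts y to y - lam n.\<close>

lemma perron_riesz_mean:
  assumes freq: "frequency lam" and c: "0 < c" and M: "2 \<le> M"
  shows "(\<integral>t. riesz_mean lam m a x (Complex c t) * exp (of_real y * Complex c t) / Complex c t ^ Suc M \<partial>lborel)
    = of_real (2 * pi / fact M) * (\<Sum>n | lam n < x. a n * of_real ((1 - lam n / x) powr m * (max (y - lam n) 0) ^ M))"
proof -
  let ?c = "\<lambda>n. a n * of_real ((1 - lam n / x) powr m)"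
  have int: "integrable lborel (\<lambda>t. exp (of_real (y - lam n) * Complex c t) / Complex c t ^ Suc M)" for n
    using perron_kernel_integrable[of "\<lambda>_. 1" c 0 "Suc M" 1 "y - lam n"] c M by simp
  have "riesz_mean lam m a x (Complex c t) * exp (of_real y * Complex c t) / Complex c t ^ Suc M
      = (\<Sum>n | lam n < x. ?c n * (exp (of_real (y - lam n) * Complex c t) / Complex c t ^ Suc M))" for t
    unfolding riesz_mean_def sum_distrib_right sum_divide_distrib
    by (intro sum.cong) (simp_all add: left_diff_distrib exp_diff exp_minus field_simps)
  then have "(\<integral>t. riesz_mean lam m a x (Complex c t) * exp (of_real y * Complex c t) / Complex c t ^ Suc M \<partial>lborel)
      = (\<integral>t. (\<Sum>n | lam n < x. ?c n * (exp (of_real (y - lam n) * Complex c t) / Complex c t ^ Suc M)) \<partial>lborel)"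
    by (simp only:)
  also have "\<dots> = (\<Sum>n | lam n < x. \<integral>t. ?c n * (exp (of_real (y - lam n) * Complex c t) / Complex c t ^ Suc M) \<partial>lborel)"
    by (intro Bochner_Integration.integral_sum integrable_mult_right int)
  also have "\<dots> = (\<Sum>n | lam n < x. ?c n * (\<integral>t. exp (of_real (y - lam n) * Complex c t) / Complex c t ^ Suc M \<partial>lborel))"
    by (simp only: integral_mult_right_zero)
  also have "\<dots> = (\<Sum>n | lam n < x. ?c n * of_real (2 * pi * (max (y - lam n) 0) ^ M / fact M))"
    unfolding perron_power[OF c M] ..
  finally show ?thesis
    by (simp add: sum_distrib_left mult_ac)
qed

text \<open>No growth of f is available here, only convergence of its Riesz means far to the right.
  Their polynomial growth along a vertical line is outweighed by a kernel of high enough order, and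
  dominated convergence passes Perron's formula from the means to f.\<close>

lemma perron_formula_high_order:
  assumes freq: "frequency lam" and holo: "f holomorphic_on half_plane 0" and germ: "riesz_germ lam a f"
  shows "\<exists>c>0. \<exists>M\<ge>k. \<forall>y. (\<integral>t. f (Complex c t) * exp (of_real y * Complex c t) / Complex c t ^ Suc M \<partial>lborel)
    = of_real (2 * pi / fact M) * riesz_sum lam M a y"
proof -
  obtain m \<sigma> where m: "0 \<le> m" and \<sigma>: "0 \<le> \<sigma>"
    and lim: "\<And>s. s \<in> half_plane \<sigma> \<Longrightarrow> ((\<lambda>x. riesz_mean lam m a x s) \<longlongrightarrow> f s) at_top"
    using germ unfolding riesz_germ_def by blast
  define K where "K = nat \<lceil>m\<rceil> + 1"
  have K: "0 < K" "m + 1 \<le> real K"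
    unfolding K_def using m by (auto intro: of_nat_ceiling)
  have limK: "((\<lambda>x. riesz_mean lam (real K) a x s) \<longlongrightarrow> f s) at_top" if "s \<in> half_plane \<sigma>" for s
    by (rule riesz_mean_tendsto_higher_order[OF freq m K(2) lim[OF that]])
  \<comment> \<open>The means converge, hence are bounded, at \<open>s0\<close>; the line of
    integration lies one unit further right, so that the growth estimate on Re z = 1 applies after
    recentring at \<open>s0\<close>.\<close>
  define s0 where "s0 = complex_of_real (\<sigma> + 1)"
  define c where "c = \<sigma> + 2"
  define b where "b n = a n * exp (- of_real (lam n) * s0)" for n
  have b_eq: "b = (\<lambda>n. a n * exp (- of_real (lam n) * s0))"
    by (simp add: b_def fun_eq_iff)
  have c: "0 < c" "2 \<le> c" using \<sigma> by (auto simp: c_def)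
  have "s0 \<in> half_plane \<sigma>" by (simp add: s0_def)
  from riesz_mean_bounded[OF freq _ limK[OF this]] obtain D where D: "0 \<le> D"
    "\<And>x. 0 < x \<Longrightarrow> norm (riesz_mean lam (real K) a x s0) \<le> D" by auto
  have bK: "norm (riesz_sum lam K b t) \<le> D * t ^ K" if "0 < t" for t
    using D(2)[OF that] that riesz_mean_eq_riesz_sum[OF that, of lam K a s0]
    by (simp add: b_eq norm_divide norm_power field_simps)
  define E where "E = D * (1 + 2 ^ Suc K) * (1 + real K) ^ Suc K"
  have growth: "norm (riesz_mean lam (real K) a x (Complex c t)) \<le> E * norm (Complex c t) ^ Suc K"
    if "1 \<le> x" for x t
  proof -
    have "Complex c t = s0 + Complex 1 t"
      by (simp add: s0_def c_def complex_eq_iff)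
    then have "norm (riesz_mean lam (real K) a x (Complex c t)) = norm (riesz_mean lam (real K) b x (Complex 1 t))"
      unfolding b_def by (simp only: riesz_mean_translate)
    also have "\<dots> \<le> D * (1 + 2 ^ Suc K) * (norm (Complex 1 t) + real K) ^ Suc K"
      by (rule riesz_mean_vertical_growth[OF freq K(1) bK that]) auto
    also have "\<dots> \<le> D * (1 + 2 ^ Suc K) * ((1 + real K) * norm (Complex c t)) ^ Suc K"
    proof (intro mult_left_mono power_mono)
      have "norm (Complex 1 t) \<le> norm (Complex c t)"
        using c by (simp add: cmod_def)
      moreover have "1 \<le> norm (Complex c t)"
        using c complex_Re_le_cmod[of "Complex c t"] by simp
      then have "real K * 1 \<le> real K * norm (Complex c t)"
        by (intro mult_left_mono) auto
      ultimately show "norm (Complex 1 t) + real K \<le> (1 + real K) * norm (Complex c t)"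
        by (simp add: algebra_simps)
    qed (use D in auto)
    finally show ?thesis
      by (simp only: E_def power_mult_distrib mult.assoc)
  qed
  \<comment> \<open>The growth exponent is \<open>Suc K\<close>, so integrability of the kernel asks
    for \<open>Suc K + 2 \<le> Suc M\<close>; the summand k ensures k \<le> M.\<close>
  define M where "M = k + K + 2"
  have M: "2 \<le> M" "Suc K + 2 \<le> Suc M" "k \<le> M" by (auto simp: M_def)
  have contf: "continuous_on (half_plane 0) f"
    using holo by (rule holomorphic_on_imp_continuous_on)
  have contR: "continuous_on (half_plane 0) (riesz_mean lam m' a x)" for m' x
    unfolding riesz_mean_def by (intro continuous_intros)
  have perron: "(\<integral>t. f (Complex c t) * exp (of_real y * Complex c t) / Complex c t ^ Suc M \<partial>lborel)
    = of_real (2 * pi / fact M) * riesz_sum lam M a y" for y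
  proof -
    let ?L = "\<lambda>j. \<integral>t. riesz_mean lam (real K) a (real (Suc j)) (Complex c t) * exp (of_real y * Complex c t) / Complex c t ^ Suc M \<partial>lborel"
    have "?L \<longlonglongrightarrow> (\<integral>t. f (Complex c t) * exp (of_real y * Complex c t) / Complex c t ^ Suc M \<partial>lborel)"
    proof (rule integral_dominated_convergence)
      show "(\<lambda>t. f (Complex c t) * exp (of_real y * Complex c t) / Complex c t ^ Suc M) \<in> borel_measurable lborel"
        using vertical_line_measurable[OF perron_kernel_continuous[OF contf] c(1)] by (simp del: power_Suc)
      show "(\<lambda>t. riesz_mean lam (real K) a (real (Suc j)) (Complex c t) * exp (of_real y * Complex c t) / Complex c t ^ Suc M) \<in> borel_measurable lborel" for j
        using vertical_line_measurable[OF perron_kernel_continuous[OF contR] c(1)] by (simp del: power_Suc)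
      show "integrable lborel (\<lambda>t. (E * exp (y * c) / (c ^ (Suc M - Suc K - 2) * min 1 (c\<^sup>2))) / (1 + t\<^sup>2))"
        by (rule integrable_inverse_one_plus_square)
      show "AE t in lborel. norm (riesz_mean lam (real K) a (real (Suc j)) (Complex c t) * exp (of_real y * Complex c t) / Complex c t ^ Suc M)
          \<le> (E * exp (y * c) / (c ^ (Suc M - Suc K - 2) * min 1 (c\<^sup>2))) / (1 + t\<^sup>2)" for j
      proof (intro AE_I2)
        fix t
        show "norm (riesz_mean lam (real K) a (real (Suc j)) (Complex c t) * exp (of_real y * Complex c t) / Complex c t ^ Suc M)
          \<le> (E * exp (y * c) / (c ^ (Suc M - Suc K - 2) * min 1 (c\<^sup>2))) / (1 + t\<^sup>2)"
          using perron_kernel_bound[OF c(1) _ growth M(2), of t "real (Suc j)" y] by (simp del: power_Suc)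
      qed
      show "AE t in lborel. (\<lambda>j. riesz_mean lam (real K) a (real (Suc j)) (Complex c t) * exp (of_real y * Complex c t) / Complex c t ^ Suc M)
          \<longlonglongrightarrow> f (Complex c t) * exp (of_real y * Complex c t) / Complex c t ^ Suc M"
      proof (intro AE_I2 tendsto_divide tendsto_mult tendsto_const)
        fix t
        have "filterlim (\<lambda>j. real (Suc j)) at_top sequentially"
          using filterlim_Suc filterlim_compose filterlim_real_sequentially by blast
        from filterlim_compose[OF limK this, of "Complex c t"]
        show "(\<lambda>j. riesz_mean lam (real K) a (real (Suc j)) (Complex c t)) \<longlonglongrightarrow> f (Complex c t)"
          by (simp add: c_def)
        show "Complex c t ^ Suc M \<noteq> 0"
          using c by (intro power_not_zero) (simp add: complex_eq_iff)
      qed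
    qed
    moreover have "?L \<longlonglongrightarrow> of_real (2 * pi / fact M) * riesz_sum lam M a y"
      unfolding perron_riesz_mean[OF freq c(1) M(1)]
    proof (intro tendsto_mult tendsto_const)
      \<comment> \<open>Once the cutoff has passed y, the truncated powers remove all terms with lam
        n \<ge> y. The index set is then fixed and the weights tend to 1 term by term.\<close>
      let ?R = "\<lambda>j. \<Sum>n | lam n < y. a n * of_real ((1 - lam n / real (Suc j)) powr real K * (y - lam n) ^ M)"
      have "?R \<longlonglongrightarrow> (\<Sum>n | lam n < y. a n * of_real (1 powr real K * (y - lam n) ^ M))"
      proof (intro tendsto_sum tendsto_mult tendsto_const tendsto_of_real tendsto_powr)
        show "(\<lambda>j. 1 - lam n / real (Suc j)) \<longlonglongrightarrow> 1" for n
          by real_asymp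
      qed auto
      moreover have "\<forall>\<^sub>F j in sequentially. ?R j =
          (\<Sum>n | lam n < real (Suc j). a n * of_real ((1 - lam n / real (Suc j)) powr real K * (max (y - lam n) 0) ^ M))"
        using eventually_ge_at_top[of "nat \<lceil>y\<rceil>"]
      proof eventually_elim
        case (elim j)
        then have "y \<le> real (Suc j)" by linarith
        then show ?case
          using M by (intro sum.mono_neutral_cong_left finite_frequency_below[OF freq]) (auto simp: max_def)
      qed
      ultimately show "(\<lambda>j. \<Sum>n | lam n < real (Suc j). a n * of_real ((1 - lam n / real (Suc j)) powr real K * (max (y - lam n) 0) ^ M))
          \<longlonglongrightarrow> riesz_sum lam M a y"
        unfolding riesz_sum_def by (simp add: Lim_transform_eventually)
    qed
    ultimately show ?thesis by (rule LIMSEQ_unique)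
  qed
  then show ?thesis using c(1) M(3) by blast
qed

section \<open>Lowering the order of Perron's formula by differentiation in y\<close>

lemma positive_part_power_DERIV:
  assumes "0 < M"
  shows "((\<lambda>u::real. (max u 0) ^ Suc M) has_real_derivative real (Suc M) * (max u 0) ^ M) (at u)"
proof -
  consider "0 < u" | "u < 0" | "u = 0" by linarith
  then show ?thesis
  proof cases
    case 1
    have "((\<lambda>u::real. u ^ Suc M) has_real_derivative real (Suc M) * (max u 0) ^ M) (at u)"
      using DERIV_pow[of "Suc M" u] 1 by (simp add: max_def del: power_Suc of_nat_Suc)
    then show ?thesis
      by (rule has_field_derivative_transform_within_open[where S = "{0<..}"]) (use 1 in auto)
  next
    case 2
    have "((\<lambda>u::real. 0) has_real_derivative real (Suc M) * (max u 0) ^ M) (at u)"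
      using 2 assms by (auto simp: max_def power_0_left)
    then show ?thesis
      by (rule has_field_derivative_transform_within_open[where S = "{..<0}"]) (use 2 in \<open>auto simp: max_def\<close>)
  next
    case 3
    \<comment> \<open>At the corner the quotient is at most |h|^M, which tends to 0 because M >
      0.\<close>
    have "((\<lambda>h::real. (max h 0) ^ Suc M / h) \<longlongrightarrow> 0) (at 0)"
    proof (rule Lim_null_comparison)
      show "\<forall>\<^sub>F h in at 0. norm ((max h 0) ^ Suc M / h) \<le> \<bar>h\<bar> ^ M"
        by (intro always_eventually allI) (auto simp: max_def assms)
      show "((\<lambda>h::real. \<bar>h\<bar> ^ M) \<longlongrightarrow> 0) (at 0)"
        using assms by (auto intro!: tendsto_eq_intros)
    qed
    then show ?thesis using 3 assms by (simp add: DERIV_def power_0_left)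
  qed
qed

lemma filterlim_inverse_Suc: "filterlim (\<lambda>j. inverse (real (Suc j))) (at 0) sequentially"
  by (auto simp: filterlim_at simp del: of_nat_Suc intro!: LIMSEQ_inverse_real_of_nat)

text \<open>Majorant for differentiating under the integral sign: a difference quotient in y costs
  one power of |w|, uniformly in the step h.\<close>

lemma norm_exp_diff_quotient_le:
  assumes "0 \<le> Re w" "0 < h" "h \<le> 1"
  shows "norm ((exp (of_real h * w) - 1) / of_real h) \<le> exp (Re w) * norm w"
proof -
  have "norm (exp (of_real h * w) - exp 0) \<le> exp (Re w) * norm (of_real h * w - 0)"
  proof (rule field_differentiable_bound[where S = "closed_segment 0 (of_real h * w)"])
    fix z assume "z \<in> closed_segment 0 (of_real h * w)"
    then obtain r where r: "0 \<le> r" "r \<le> 1" "z = of_real r * (of_real h * w)"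
      by (auto simp: in_segment scaleR_conv_of_real)
    have "Re z = (r * h) * Re w" using r by simp
    also have "\<dots> \<le> 1 * Re w"
      using r assms by (intro mult_right_mono mult_le_one) auto
    finally show "norm (exp z) \<le> exp (Re w)" by simp
  qed (auto intro!: derivative_eq_intros)
  then have "norm (exp (of_real h * w) - 1) \<le> exp (Re w) * (h * norm w)"
    using assms by (simp add: norm_mult)
  then show ?thesis using assms by (simp add: norm_divide field_simps)
qed

text \<open>Difference quotients in y of the formula of order M + 1. On the left the factor w
  cancels one power of the kernel, and p + 2 \<le> M + 1 keeps the majorant integrable; on the right
  the truncated power is differentiated.\<close>

lemma perron_formula_lower_order:
  assumes freq: "frequency lam" and c: "0 < c" and cont: "continuous_on (half_plane 0) f"
    and bound: "\<And>t. norm (f (Complex c t)) \<le> E * norm (Complex c t) ^ p" and M: "0 < M" "p + 2 \<le> Suc M"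
    and perron: "\<And>y. (\<integral>t. f (Complex c t) * exp (of_real y * Complex c t) / Complex c t ^ Suc (Suc M) \<partial>lborel)
      = of_real (2 * pi / fact (Suc M)) * riesz_sum lam (Suc M) a y"
  shows "(\<integral>t. f (Complex c t) * exp (of_real y * Complex c t) / Complex c t ^ Suc M \<partial>lborel)
      = of_real (2 * pi / fact M) * riesz_sum lam M a y"
proof -
  define h where "h j = inverse (real (Suc j))" for j
  have h: "0 < h j" "h j \<le> 1" for j
    by (auto simp: h_def field_simps)
  let ?W = "\<lambda>t. Complex c t"
  let ?q = "\<lambda>j w. (exp (of_real (h j) * w) - 1) / of_real (h j)"
  let ?I = "\<lambda>y. \<integral>t. f (?W t) * exp (of_real y * ?W t) / ?W t ^ Suc (Suc M) \<partial>lborel"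
  let ?L = "\<lambda>j. \<integral>t. f (?W t) * ?q j (?W t) * exp (of_real y * ?W t) / ?W t ^ Suc (Suc M) \<partial>lborel"
  have int: "integrable lborel (\<lambda>t. f (?W t) * exp (of_real y * ?W t) / ?W t ^ Suc (Suc M))" for y
    by (rule perron_kernel_integrable[OF cont c _ bound]) (use M in auto)
  have Lj: "?L j = (?I (y + h j) - ?I y) / of_real (h j)" for j
  proof -
    have pw: "f w * ?q j w * exp (of_real y * w) / w ^ Suc (Suc M) =
      (f w * exp (of_real (y + h j) * w) / w ^ Suc (Suc M) - f w * exp (of_real y * w) / w ^ Suc (Suc M)) / of_real (h j)" for w
      by (simp add: distrib_right exp_add diff_divide_distrib algebra_simps)
    show ?thesis
      by (simp only: pw integral_divide_zero Bochner_Integration.integral_diff[OF int int])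
  qed
  have "?L \<longlonglongrightarrow> (\<integral>t. f (?W t) * exp (of_real y * ?W t) / ?W t ^ Suc M \<partial>lborel)"
  proof (rule integral_dominated_convergence)
    have contq: "continuous_on (half_plane 0) (\<lambda>w. f w * ?q j w)" for j
      using h(1)[of j] by (intro continuous_intros cont) auto
    show "(\<lambda>t. f (?W t) * exp (of_real y * ?W t) / ?W t ^ Suc M) \<in> borel_measurable lborel"
      using vertical_line_measurable[OF perron_kernel_continuous[OF cont] c] by (simp del: power_Suc)
    show "(\<lambda>t. f (?W t) * ?q j (?W t) * exp (of_real y * ?W t) / ?W t ^ Suc (Suc M)) \<in> borel_measurable lborel" for j
      using vertical_line_measurable[OF perron_kernel_continuous[OF contq] c] by (simp del: power_Suc)
    show "integrable lborel (\<lambda>t. ((E * exp c) * exp (y * c) / (c ^ (Suc (Suc M) - Suc p - 2) * min 1 (c\<^sup>2))) / (1 + t\<^sup>2))"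
      by (rule integrable_inverse_one_plus_square)
    show "AE t in lborel. norm (f (?W t) * ?q j (?W t) * exp (of_real y * ?W t) / ?W t ^ Suc (Suc M)) \<le>
        ((E * exp c) * exp (y * c) / (c ^ (Suc (Suc M) - Suc p - 2) * min 1 (c\<^sup>2))) / (1 + t\<^sup>2)" for j
    proof (intro AE_I2)
      fix t
      have "norm (?q j (?W t)) \<le> exp c * norm (?W t)"
        using norm_exp_diff_quotient_le[of "?W t" "h j"] c h by simp
      then have "norm (f (?W t) * ?q j (?W t)) \<le> E * norm (?W t) ^ p * (exp c * norm (?W t))"
        unfolding norm_mult[of "f (?W t)"]
        by (intro mult_mono bound) (auto intro: order_trans[OF norm_ge_zero bound])
      then have "norm (f (?W t) * ?q j (?W t)) \<le> (E * exp c) * norm (?W t) ^ Suc p"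
        by (simp add: mult_ac)
      from perron_kernel_bound[OF c _ this, of "Suc (Suc M)" y] M
      show "norm (f (?W t) * ?q j (?W t) * exp (of_real y * ?W t) / ?W t ^ Suc (Suc M)) \<le>
        ((E * exp c) * exp (y * c) / (c ^ (Suc (Suc M) - Suc p - 2) * min 1 (c\<^sup>2))) / (1 + t\<^sup>2)"
        by (simp del: power_Suc)
    qed
    show "AE t in lborel. (\<lambda>j. f (?W t) * ?q j (?W t) * exp (of_real y * ?W t) / ?W t ^ Suc (Suc M))
        \<longlonglongrightarrow> f (?W t) * exp (of_real y * ?W t) / ?W t ^ Suc M"
    proof (intro AE_I2)
      fix t
      have W0: "?W t \<noteq> 0"
        using c by (simp add: complex_eq_iff)
      have "((\<lambda>z. exp (z * ?W t)) has_field_derivative ?W t) (at 0)"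
        by (auto intro!: derivative_eq_intros)
      then have "((\<lambda>z. (exp (z * ?W t) - 1) / z) \<longlongrightarrow> ?W t) (at 0)"
        by (simp add: DERIV_def)
      moreover have "filterlim (\<lambda>j. complex_of_real (h j)) (at 0) sequentially"
      proof -
        have "(\<lambda>j. complex_of_real (h j)) \<longlonglongrightarrow> of_real 0"
          unfolding h_def by (intro tendsto_of_real LIMSEQ_inverse_real_of_nat)
        moreover have "h j \<noteq> 0" for j using h(1)[of j] by simp
        ultimately show ?thesis by (simp add: filterlim_at)
      qed
      ultimately have "(\<lambda>j. ?q j (?W t)) \<longlonglongrightarrow> ?W t"
        by (rule filterlim_compose)
      then have "(\<lambda>j. f (?W t) * ?q j (?W t) * exp (of_real y * ?W t) / ?W t ^ Suc (Suc M))
          \<longlonglongrightarrow> f (?W t) * ?W t * exp (of_real y * ?W t) / ?W t ^ Suc (Suc M)"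
        using W0 by (intro tendsto_intros power_not_zero)
      moreover have "f (?W t) * ?W t * exp (of_real y * ?W t) / ?W t ^ Suc (Suc M) = f (?W t) * exp (of_real y * ?W t) / ?W t ^ Suc M"
        using W0 by simp
      ultimately show "(\<lambda>j. f (?W t) * ?q j (?W t) * exp (of_real y * ?W t) / ?W t ^ Suc (Suc M))
        \<longlonglongrightarrow> f (?W t) * exp (of_real y * ?W t) / ?W t ^ Suc M" by simp
    qed
  qed
  moreover have "?L \<longlonglongrightarrow> of_real (2 * pi / fact M) * riesz_sum lam M a y"
  proof -
    let ?d = "\<lambda>j n. ((max (y - lam n + h j) 0) ^ Suc M - (max (y - lam n) 0) ^ Suc M) / h j"
    \<comment> \<open>Since h j \<le> 1, the index set lam n < y + 1 serves both sums and is
      independent of j.\<close>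
    have eq: "?L j = of_real (2 * pi / fact (Suc M)) * (\<Sum>n | lam n < y + 1. a n * of_real (?d j n))" for j
    proof -
      have "riesz_sum lam (Suc M) a (y + h j) - riesz_sum lam (Suc M) a y =
        (\<Sum>n | lam n < y + 1. a n * of_real ((max (y - lam n + h j) 0) ^ Suc M - (max (y - lam n) 0) ^ Suc M))"
        using riesz_sum_eq_positive_part[OF freq, of "y + h j" "y + 1" "Suc M" a]
          riesz_sum_eq_positive_part[OF freq, of y "y + 1" "Suc M" a] h[of j]
        by (simp add: right_diff_distrib sum_subtractf algebra_simps del: power_Suc)
      then have "(riesz_sum lam (Suc M) a (y + h j) - riesz_sum lam (Suc M) a y) / of_real (h j) =
        (\<Sum>n | lam n < y + 1. a n * of_real (?d j n))"
        by (simp add: sum_divide_distrib)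
      then show ?thesis
        unfolding Lj perron by (metis (no_types, lifting) right_diff_distrib times_divide_eq_right)
    qed
    have "(\<lambda>j. \<Sum>n | lam n < y + 1. a n * of_real (?d j n)) \<longlonglongrightarrow>
        (\<Sum>n | lam n < y + 1. a n * of_real (real (Suc M) * (max (y - lam n) 0) ^ M))"
    proof (intro tendsto_sum tendsto_mult tendsto_const tendsto_of_real)
      fix n
      have "((\<lambda>h. ((max (y - lam n + h) 0) ^ Suc M - (max (y - lam n) 0) ^ Suc M) / h)
          \<longlongrightarrow> real (Suc M) * (max (y - lam n) 0) ^ M) (at 0)"
        using positive_part_power_DERIV[OF M(1), of "y - lam n"] by (simp only: DERIV_def)
      from filterlim_compose[OF this filterlim_inverse_Suc]
      show "(\<lambda>j. ?d j n) \<longlonglongrightarrow> real (Suc M) * (max (y - lam n) 0) ^ M"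
        by (simp only: h_def)
    qed
    moreover have "(\<Sum>n | lam n < y + 1. a n * of_real (real (Suc M) * (max (y - lam n) 0) ^ M)) = of_nat (Suc M) * riesz_sum lam M a y"
      using riesz_sum_eq_positive_part[OF freq, of y "y + 1" M a] M by (simp add: sum_distrib_left mult_ac)
    ultimately have "?L \<longlonglongrightarrow> of_real (2 * pi / fact (Suc M)) * (of_nat (Suc M) * riesz_sum lam M a y)"
      unfolding eq by (intro tendsto_mult tendsto_const) simp
    moreover have "of_real (2 * pi / fact (Suc M)) * (of_nat (Suc M) * riesz_sum lam M a y) = of_real (2 * pi / fact M) * riesz_sum lam M a y"
    proof -
      have "2 * pi / fact (Suc M) * real (Suc M) = 2 * pi / fact M"
        by (simp add: fact_Suc del: of_nat_Suc)
      from arg_cong[OF this, of complex_of_real]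
      have "complex_of_real (2 * pi / fact (Suc M)) * of_nat (Suc M) = of_real (2 * pi / fact M)"
        by (simp only: of_real_mult of_real_of_nat_eq)
      then show ?thesis
        by (simp only: mult.assoc[symmetric])
    qed
    ultimately show ?thesis by simp
  qed
  ultimately show ?thesis by (rule LIMSEQ_unique)
qed

text \<open>The line and the order supplied by the germ are forgotten here. Polynomial growth of f
  permits descending from the high order to k on the line given by the germ, and then moving that
  line to any c > 0.\<close>

lemma perron_formula:
  assumes freq: "frequency lam" and holo: "f holomorphic_on half_plane 0" and germ: "riesz_germ lam a f"
    and bound: "\<And>s. 0 < Re s \<Longrightarrow> norm (f s) \<le> C * (1 + norm s) ^ p"
    and k: "p + 2 \<le> k" and c: "0 < c"
  shows "(\<integral>t. f (Complex c t) * exp (of_real y * Complex c t) / Complex c t ^ Suc k \<partial>lborel)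
      = of_real (2 * pi / fact k) * riesz_sum lam k a y"
proof -
  have contf: "continuous_on (half_plane 0) f"
    using holo by (rule holomorphic_on_imp_continuous_on)
  have C: "0 \<le> C"
  proof -
    have "0 \<le> C * 2 ^ p"
      using order_trans[OF norm_ge_zero bound[of 1]] by simp
    then show ?thesis
      using mult_neg_pos[of C "2 ^ p"] by (metis not_le zero_less_numeral zero_less_power)
  qed
  \<comment> \<open>To the right of c' one has 1 \<le> |w| / c', so 1 + |w| is at most (1 + 1 / c')
    |w|.\<close>
  have bd: "norm (f w) \<le> C * (1 + 1 / c') ^ p * norm w ^ p" if "0 < c'" "c' \<le> Re w" for c' w
  proof -
    have "c' \<le> norm w" using that complex_Re_le_cmod[of w] by linarith
    then have "1 + norm w \<le> (1 + 1 / c') * norm w"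
      using that by (simp add: field_simps)
    then have "(1 + norm w) ^ p \<le> ((1 + 1 / c') * norm w) ^ p"
      by (intro power_mono) auto
    then have "C * (1 + norm w) ^ p \<le> C * ((1 + 1 / c') * norm w) ^ p"
      using C by (rule mult_left_mono)
    then show ?thesis
      using bound[of w] that by (simp add: power_mult_distrib mult.assoc)
  qed
  obtain c' M where c': "0 < c'" and M: "k \<le> M" and P: "\<And>y. (\<integral>t. f (Complex c' t) * exp (of_real y * Complex c' t) / Complex c' t ^ Suc M \<partial>lborel)
    = of_real (2 * pi / fact M) * riesz_sum lam M a y"
    using perron_formula_high_order[OF freq holo germ, of k] by blast
  have Q: "\<forall>y. (\<integral>t. f (Complex c' t) * exp (of_real y * Complex c' t) / Complex c' t ^ Suc k \<partial>lborel)
    = of_real (2 * pi / fact k) * riesz_sum lam k a y"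
    using M
  \<comment> \<open>Downward induction from M to k; every order n met satisfies n \<ge> k \<ge> p +
    2, which keeps the kernel integrable.\<close>
  proof (induction rule: inc_induct)
    case base
    then show ?case using P by blast
  next
    case (step n)
    show ?case
    proof
      fix y
      show "(\<integral>t. f (Complex c' t) * exp (of_real y * Complex c' t) / Complex c' t ^ Suc n \<partial>lborel)
        = of_real (2 * pi / fact n) * riesz_sum lam n a y"
        by (rule perron_formula_lower_order[OF freq c' contf bd[OF c']]) (use step k in auto)
    qed
  qed
  let ?g = "\<lambda>w. f w * exp (of_real y * w) / w ^ Suc k"
  have shift: "(\<integral>t. ?g (Complex c1 t) \<partial>lborel) = (\<integral>t. ?g (Complex c2 t) \<partial>lborel)" if "0 < c1" "c1 \<le> c2" for c1 c2
  proof (rule vertical_integral_shift)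
    show "?g holomorphic_on half_plane 0"
      using holo by (intro holomorphic_intros) auto
    fix w assume w: "c1 \<le> Re w" "Re w \<le> c2"
    let ?A = "C * (1 + 1 / c1) ^ p / (c1 ^ (Suc k - p - 2) * min 1 (c1\<^sup>2))"
    have A: "0 \<le> ?A" using C that by auto
    have "norm (?g w) \<le> (C * (1 + 1 / c1) ^ p * exp (y * Re w) / (c1 ^ (Suc k - p - 2) * min 1 (c1\<^sup>2))) / (1 + (Im w)\<^sup>2)"
      using perron_kernel_bound[OF that(1) w(1) bd[OF that(1) w(1)], of "Suc k" y] k by (simp del: power_Suc)
    also have "\<dots> = ?A * exp (y * Re w) / (1 + (Im w)\<^sup>2)"
      by simp
    also have "\<dots> \<le> ?A * exp (\<bar>y\<bar> * c2) / (1 + (Im w)\<^sup>2)"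
    proof (intro divide_right_mono mult_left_mono A)
      have "y * Re w \<le> \<bar>y\<bar> * c2"
        using w that by (intro mult_mono) auto
      then show "exp (y * Re w) \<le> exp (\<bar>y\<bar> * c2)" by simp
    qed auto
    finally show "norm (?g w) \<le> ?A * exp (\<bar>y\<bar> * c2) / (1 + (Im w)\<^sup>2)" .
  qed (use that in auto)
  have "(\<integral>t. ?g (Complex c t) \<partial>lborel) = (\<integral>t. ?g (Complex c' t) \<partial>lborel)"
  proof (cases "c \<le> c'")
    case True
    then show ?thesis by (rule shift[OF c])
  next
    case False
    then show ?thesis by (intro shift[OF c', symmetric]) simp
  qed
  then show ?thesis using Q by simp
qed

subsection \<open>Uniform approximation and compactness\<close>

lemma weight_add_le:
  fixes s w :: complex
  assumes "0 \<le> l"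
  shows "(1 + norm (s + w)) powr l \<le> (1 + norm s) powr l * (1 + norm w) powr l"
proof -
  have "1 + norm (s + w) \<le> (1 + norm s) * (1 + norm w)"
  proof -
    have "0 \<le> norm s * norm w" by simp
    moreover have "(1 + norm s) * (1 + norm w) = 1 + norm s + norm w + norm s * norm w"
      by (simp add: algebra_simps)
    ultimately show ?thesis
      using norm_triangle_ineq[of s w] by linarith
  qed
  then have "(1 + norm (s + w)) powr l \<le> ((1 + norm s) * (1 + norm w)) powr l"
    using assms by (intro powr_mono2) auto
  then show ?thesis by (simp add: powr_mult)
qed

lemma weight_le_power:
  fixes w :: complex
  shows "(1 + norm w) powr l \<le> (1 + norm w) ^ nat \<lceil>l\<rceil>"
proof -
  have "(1 + norm w) powr l \<le> (1 + norm w) powr real (nat \<lceil>l\<rceil>)"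
    by (intro powr_mono) (auto intro: real_nat_ceiling_ge)
  also have "\<dots> = (1 + norm w) ^ nat \<lceil>l\<rceil>"
    by (intro powr_realpow) (simp add: add_pos_nonneg)
  finally show ?thesis .
qed

lemma one_le_weight:
  fixes s :: complex
  assumes "0 \<le> l"
  shows "1 \<le> (1 + norm s) powr l"
  using assms by (intro ge_one_powr_ge_zero) auto

lemma riesz_germ_translate:
  assumes "riesz_germ lam a f" "0 \<le> Re u"
  shows "riesz_germ lam (\<lambda>n. a n * exp (- of_real (lam n) * u)) (\<lambda>s. f (u + s))"
proof -
  obtain m \<sigma> where "0 \<le> m" "0 \<le> \<sigma>"
    and lim: "\<And>s. s \<in> half_plane \<sigma> \<Longrightarrow> ((\<lambda>x. riesz_mean lam m a x s) \<longlongrightarrow> f s) at_top"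
    using assms(1) unfolding riesz_germ_def by blast
  moreover have "((\<lambda>x. riesz_mean lam m (\<lambda>n. a n * exp (- of_real (lam n) * u)) x s) \<longlongrightarrow> f (u + s)) at_top"
    if "s \<in> half_plane \<sigma>" for s
    using lim[of "u + s"] that assms(2) by (simp add: riesz_mean_translate)
  ultimately show ?thesis
    unfolding riesz_germ_def by blast
qed

lemma holomorphic_on_translate:
  assumes "f holomorphic_on half_plane 0" "0 \<le> Re u"
  shows "(\<lambda>s. f (u + s)) holomorphic_on half_plane 0"
proof -
  have "f holomorphic_on (\<lambda>s. u + s) ` half_plane 0"
    using assms(2) by (intro holomorphic_on_subset[OF assms(1)]) auto
  from holomorphic_on_compose[OF _ this] show ?thesis
    by (simp add: o_def holomorphic_intros)
qed

text \<open>Cauchy's inequality on discs of radius u/2 about the points of the segment, which stay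
  in the half-plane. The radius gives 2 / u, and the enlargement of the modulus is absorbed by (1 +
  u)^l.\<close>

lemma lipschitz_from_growth:
  assumes holo: "f holomorphic_on half_plane 0" and l: "0 \<le> l" and u: "0 < u" and C: "0 \<le> C"
    and bound: "\<And>s. 0 < Re s \<Longrightarrow> norm (f s) \<le> C * (1 + norm s) powr l"
    and s: "u < Re s" and w: "0 \<le> Re w"
  shows "norm (f (s + w) - f s) \<le> 2 / u * (1 + u) powr l * C * (1 + norm s) powr l * (1 + norm w) powr l * norm w"
proof -
  define B where "B = C * ((1 + u) powr l * ((1 + norm s) powr l * (1 + norm w) powr l))"
  have seg: "u < Re z \<and> norm z \<le> norm s + norm w" if z: "z \<in> closed_segment s (s + w)" for z
  proof -
    obtain r where r: "0 \<le> r" "r \<le> 1" "z = s + of_real r * w"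
      using z by (auto simp: in_segment scaleR_conv_of_real algebra_simps)
    have "norm z \<le> norm s + r * norm w"
      using norm_triangle_ineq[of s "of_real r * w"] r by (simp add: norm_mult)
    also have "\<dots> \<le> norm s + norm w"
      using r by (simp add: mult_left_le_one_le)
    finally have "norm z \<le> norm s + norm w" .
    moreover have "0 \<le> r * Re w" using r w by simp
    ultimately show ?thesis using r s by simp
  qed
  have "norm (f (s + w) - f s) \<le> B / (u / 2) * norm (s + w - s)"
  proof (rule field_differentiable_bound[where S = "closed_segment s (s + w)" and f' = "deriv f"])
    fix z assume z: "z \<in> closed_segment s (s + w)"
    have sub: "cball z (u / 2) \<subseteq> half_plane 0"
    proof
      fix v assume "v \<in> cball z (u / 2)"
      then have "\<bar>Re z - Re v\<bar> \<le> u / 2"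
        using abs_Re_le_cmod[of "z - v"] by (simp add: dist_norm)
      then have "0 < Re v" using seg[OF z] u by (smt (verit) field_sum_of_halves)
      then show "v \<in> half_plane 0" by simp
    qed
    have "(f has_field_derivative deriv f z) (at z)"
      by (rule holomorphic_derivI[OF holo open_half_plane]) (use seg[OF z] u in simp)
    then show "(f has_field_derivative deriv f z) (at z within closed_segment s (s + w))"
      by (rule has_field_derivative_at_within)
    have "norm ((deriv ^^ 1) f z) \<le> fact 1 * B / (u / 2) ^ 1"
    proof (rule Cauchy_inequality)
      show "f holomorphic_on ball z (u / 2)"
        using sub ball_subset_cball by (intro holomorphic_on_subset[OF holo]) blast
      show "continuous_on (cball z (u / 2)) f"
        using sub by (intro continuous_on_subset[OF holomorphic_on_imp_continuous_on[OF holo]])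
      show "0 < u / 2" using u by simp
      fix v assume v: "norm (z - v) = u / 2"
      then have "v \<in> half_plane 0" using sub by (auto simp: dist_norm)
      then have "norm (f v) \<le> C * (1 + norm v) powr l" by (intro bound) simp
      also have "\<dots> \<le> C * ((1 + u) * ((1 + norm s) * (1 + norm w))) powr l"
      proof (intro mult_left_mono powr_mono2 C l)
        have "norm v \<le> norm z + norm (z - v)"
          using norm_triangle_ineq4[of z "z - v"] by simp
        then have "1 + norm v \<le> 1 + norm s + norm w + u"
          using seg[OF z] v u by linarith
        also have "\<dots> \<le> (1 + u) * ((1 + norm s) * (1 + norm w))"
          using u by (simp add: algebra_simps)
        finally show "1 + norm v \<le> (1 + u) * ((1 + norm s) * (1 + norm w))" .
      qed auto
      also have "\<dots> = B"
        using u by (simp add: B_def powr_mult)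
      finally show "norm (f v) \<le> B" .
    qed
    then show "norm (deriv f z) \<le> B / (u / 2)" by simp
  qed auto
  then show ?thesis
    by (simp add: B_def mult_ac)
qed

text \<open>Perron's formula for w \<mapsto> f (s + w) minus the one for the constant f s. The
  constant \<open>D\<close> is chosen before f, its germ and x, so neither the order nor the
  abscissa of the germ enters the estimate.\<close>

lemma riesz_approximation:
  fixes l u :: real
  assumes freq: "frequency lam" and l: "0 \<le> l" and u: "0 < u"
  defines "k \<equiv> nat \<lceil>l\<rceil> + 2"
  obtains D where "0 \<le> D" and
    "\<And>f a C x s. \<lbrakk>f holomorphic_on half_plane 0; riesz_germ lam a f; 0 \<le> C;
      \<And>s. 0 < Re s \<Longrightarrow> norm (f s) \<le> C * (1 + norm s) powr l; 1 \<le> x; u < Re s\<rbrakk> \<Longrightarrow>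
      norm (riesz_mean lam (real k) a x s - f s) \<le> D * C / x * (1 + norm s) powr l"
proof -
  define p where "p = nat \<lceil>l\<rceil>"
  have k: "k = p + 2" by (simp add: k_def p_def)
  define I :: real where "I = (\<integral>t. 1 / (1 + t\<^sup>2) \<partial>lborel)"
  have I: "0 \<le> I" unfolding I_def by (intro integral_nonneg_AE) auto
  \<comment> \<open>Origin of the factors: the Perron constant, the Lipschitz bound, |exp (x w)| =
    e, the estimate 1 + r \<le> 2 x r to the power p, and the integral of 1 / (1 + t^2).\<close>
  define D where "D = fact k / (2 * pi) * (2 / u * (1 + u) powr l * exp 1 * 2 ^ p * I)"
  have approx: "norm (riesz_mean lam (real k) a x s - f s) \<le> D * C / x * (1 + norm s) powr l"
    if holo: "f holomorphic_on half_plane 0" and germ: "riesz_germ lam a f" and C: "0 \<le> C"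
      and bound: "\<And>s. 0 < Re s \<Longrightarrow> norm (f s) \<le> C * (1 + norm s) powr l"
      and x: "1 \<le> x" and s: "u < Re s" for f a C x s
  proof -
    define S where "S = (1 + norm s) powr l"
    define A where "A = 2 / u * (1 + u) powr l * C * S"
    have A: "0 \<le> A" using u C by (simp add: A_def S_def)
    define c where "c = 1 / x"
    have c: "0 < c" using x by (simp add: c_def)
    let ?W = "\<lambda>t. Complex c t"
    have gbound: "norm (f (s + w)) \<le> (C * S) * (1 + norm w) ^ p" if "0 < Re w" for w
    proof -
      have "norm (f (s + w)) \<le> C * (1 + norm (s + w)) powr l"
        using that s u by (intro bound) simp
      also have "\<dots> \<le> C * (S * (1 + norm w) ^ p)"
        unfolding S_def p_def using C
        by (intro mult_left_mono order_trans[OF weight_add_le[OF l]] weight_le_power) auto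
      finally show ?thesis by (simp add: mult.assoc)
    qed
    have gholo: "(\<lambda>w. f (s + w)) holomorphic_on half_plane 0"
      using s u by (intro holomorphic_on_translate[OF holo]) auto
    have ggerm: "riesz_germ lam (\<lambda>n. a n * exp (- of_real (lam n) * s)) (\<lambda>w. f (s + w))"
      using s u by (intro riesz_germ_translate[OF germ]) auto
    have P1: "(\<integral>t. f (s + ?W t) * exp (of_real x * ?W t) / ?W t ^ Suc k \<partial>lborel)
        = of_real (2 * pi / fact k) * (of_real (x ^ k) * riesz_mean lam (real k) a x s)"
    proof -
      have "riesz_sum lam k (\<lambda>n. a n * exp (- of_real (lam n) * s)) x = of_real (x ^ k) * riesz_mean lam (real k) a x s"
        using riesz_mean_eq_riesz_sum[of x lam k a s] x by simp
      then show ?thesis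
        using perron_formula[OF freq gholo ggerm gbound _ c, of k x] k by (simp del: power_Suc)
    qed
    have P2: "(\<integral>t. f s * exp (of_real x * ?W t) / ?W t ^ Suc k \<partial>lborel) = of_real (2 * pi / fact k) * (of_real (x ^ k) * f s)"
    proof -
      have "(\<integral>t. f s * exp (of_real x * ?W t) / ?W t ^ Suc k \<partial>lborel)
          = (\<integral>t. f s * (exp (of_real x * ?W t) / ?W t ^ Suc k) \<partial>lborel)"
        by (simp only: times_divide_eq_right)
      also have "\<dots> = f s * (\<integral>t. exp (of_real x * ?W t) / ?W t ^ Suc k \<partial>lborel)"
        by (rule integral_mult_right_zero)
      also have "\<dots> = f s * of_real (2 * pi * (max x 0) ^ k / fact k)"
        using perron_power[OF c, of k x] k by simp
      finally show ?thesis using x by (simp add: max_def mult_ac del: power_Suc)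
    qed
    have int1: "integrable lborel (\<lambda>t. f (s + ?W t) * exp (of_real x * ?W t) / ?W t ^ Suc k)"
    proof (rule perron_kernel_integrable[where g = "\<lambda>w. f (s + w)" and p = p and E = "C * S * (1 + x) ^ p"])
      show "continuous_on (half_plane 0) (\<lambda>w. f (s + w))"
        by (rule holomorphic_on_imp_continuous_on[OF gholo])
      fix t
      have "c \<le> norm (?W t)" using complex_Re_le_cmod[of "?W t"] by simp
      then have "1 + norm (?W t) \<le> (1 + x) * norm (?W t)"
        using x by (simp add: c_def field_simps)
      then have "(1 + norm (?W t)) ^ p \<le> ((1 + x) * norm (?W t)) ^ p"
        by (intro power_mono) auto
      then have "C * S * (1 + norm (?W t)) ^ p \<le> C * S * ((1 + x) * norm (?W t)) ^ p"
        using C by (intro mult_left_mono) (auto simp: S_def)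
      then show "norm (f (s + ?W t)) \<le> C * S * (1 + x) ^ p * norm (?W t) ^ p"
        using gbound[of "?W t"] c by (simp add: power_mult_distrib mult.assoc)
    qed (use c k in auto)
    have int2: "integrable lborel (\<lambda>t. f s * exp (of_real x * ?W t) / ?W t ^ Suc k)"
      by (rule perron_kernel_integrable[where g = "\<lambda>w. f s" and p = 0 and E = "norm (f s)"]) (use c k in auto)
    have diff: "of_real (2 * pi / fact k) * of_real (x ^ k) * (riesz_mean lam (real k) a x s - f s)
      = (\<integral>t. f (s + ?W t) * exp (of_real x * ?W t) / ?W t ^ Suc k - f s * exp (of_real x * ?W t) / ?W t ^ Suc k \<partial>lborel)"
      unfolding Bochner_Integration.integral_diff[OF int1 int2] P1 P2 by (simp only: right_diff_distrib mult.assoc)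
    have integrand: "norm (f (s + ?W t) * exp (of_real x * ?W t) / ?W t ^ Suc k - f s * exp (of_real x * ?W t) / ?W t ^ Suc k)
      \<le> A * exp 1 * 2 ^ p * x ^ k * (1 / (1 + (0 + x * t)\<^sup>2))" for t
    proof -
      define r where "r = norm (?W t)"
      have r: "0 < r" "c \<le> r" using c complex_Re_le_cmod[of "?W t"] by (auto simp: r_def)
      have xr: "1 \<le> x * r" using r x by (simp add: c_def field_simps)
      have "norm (f (s + ?W t) - f s) \<le> A * (1 + r) powr l * r"
        using lipschitz_from_growth[OF holo l u C bound s, of "?W t"] c
        by (simp add: A_def S_def r_def)
      also have "\<dots> \<le> A * (2 * (x * r)) ^ p * r"
      proof (intro mult_left_mono mult_right_mono A)
        have "(1 + r) powr l \<le> (1 + r) ^ p"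
          unfolding r_def p_def by (rule weight_le_power)
        also have "\<dots> \<le> (2 * (x * r)) ^ p"
        proof (rule power_mono)
          have "1 * r \<le> x * r" using x r by (intro mult_right_mono) auto
          then show "1 + r \<le> 2 * (x * r)" using xr by linarith
        qed (use r in auto)
        finally show "(1 + r) powr l \<le> (2 * (x * r)) ^ p" .
      qed (use r in auto)
      finally have lip: "norm (f (s + ?W t) - f s) \<le> A * (2 * (x * r)) ^ p * r" .
      have "norm (f (s + ?W t) * exp (of_real x * ?W t) / ?W t ^ Suc k - f s * exp (of_real x * ?W t) / ?W t ^ Suc k)
          = norm (f (s + ?W t) - f s) * exp 1 / r ^ Suc k"
        using x by (simp add: norm_mult norm_divide norm_power r_def c_def flip: diff_divide_distrib left_diff_distrib del: power_Suc)
      also have "\<dots> \<le> A * (2 * (x * r)) ^ p * r * exp 1 / r ^ Suc k"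
        using r lip by (intro divide_right_mono mult_right_mono) auto
      \<comment> \<open>The power of r is p + 1 - (k + 1) = -2 as k = p + 2, and x^p / r^2 = x^k /
        (x r)^2.\<close>
      also have "\<dots> = A * exp 1 * 2 ^ p * x ^ k * (1 / (x * r)\<^sup>2)"
        using r x by (simp add: k power_mult_distrib power_add power2_eq_square)
      also have "(x * r)\<^sup>2 = 1 + (0 + x * t)\<^sup>2"
      proof -
        have "r\<^sup>2 = c\<^sup>2 + t\<^sup>2" by (simp add: r_def cmod_def)
        then show ?thesis using x by (simp add: power_mult_distrib distrib_left c_def power_divide)
      qed
      finally show ?thesis .
    qed
    have int3: "integrable lborel (\<lambda>t. 1 / (1 + (0 + x * t)\<^sup>2))"
      using x lborel_integrable_real_affine[OF integrable_inverse_one_plus_square[of 1], of x 0] by simp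
    \<comment> \<open>This substitution produces the decisive factor 1/x.\<close>
    have I3: "(\<integral>t. 1 / (1 + (0 + x * t)\<^sup>2) \<partial>lborel) = I / x"
      using x lborel_integral_real_affine[of x "\<lambda>t::real. 1 / (1 + t\<^sup>2)" 0] by (simp add: I_def)
    have "2 * pi / fact k * x ^ k * norm (riesz_mean lam (real k) a x s - f s)
      = norm (of_real (2 * pi / fact k) * of_real (x ^ k) * (riesz_mean lam (real k) a x s - f s))"
      using x by (simp add: norm_mult norm_divide norm_power)
    also have "\<dots> \<le> (\<integral>t. A * exp 1 * 2 ^ p * x ^ k * (1 / (1 + (0 + x * t)\<^sup>2)) \<partial>lborel)"
      unfolding diff
      by (intro Bochner_Integration.integral_norm_bound_integral integrand integrable_mult_right int3
          Bochner_Integration.integrable_diff int1 int2)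
    also have "\<dots> = A * exp 1 * 2 ^ p * x ^ k * (I / x)"
      unfolding I3[symmetric] by (rule integral_mult_right_zero)
    finally have "2 * pi / fact k * x ^ k * norm (riesz_mean lam (real k) a x s - f s)
      \<le> 2 * pi / fact k * x ^ k * (D * C / x * S)"
      using u by (simp add: D_def A_def mult_ac)
    then show ?thesis
      unfolding S_def using x by (subst (asm) mult_le_cancel_left_pos) auto
  qed
  have "0 \<le> D" unfolding D_def using I u by simp
  then show ?thesis using approx by (rule that)
qed

text \<open>At a common order k and on the line Re w = 1, Perron's formula expresses each Riesz sum
  by the values of \<open>F j\<close>; dominated convergence needs only the common growth bound and
  pointwise convergence. The limit f is not assumed to have a germ.\<close>

lemma riesz_sum_tendsto:
  assumes freq: "frequency lam" and holo: "\<And>j. F j holomorphic_on half_plane 0"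
    and germ: "\<And>j. riesz_germ lam (a j) (F j)"
    and bound: "\<And>j s. 0 < Re s \<Longrightarrow> norm (F j s) \<le> C * (1 + norm s) ^ p"
    and k: "p + 2 \<le> k"
    and f: "continuous_on (half_plane 0) f" and lim: "\<And>s. 0 < Re s \<Longrightarrow> (\<lambda>j. F j s) \<longlonglongrightarrow> f s"
  shows "convergent (\<lambda>j. riesz_sum lam k (a j) y)"
proof -
  let ?W = "\<lambda>t. Complex 1 t"
  let ?J = "\<lambda>g. \<integral>t. g (?W t) * exp (of_real y * ?W t) / ?W t ^ Suc k \<partial>lborel"
  have C: "0 \<le> C"
  proof -
    have "0 \<le> C * 2 ^ p"
      using order_trans[OF norm_ge_zero bound[of 1]] by simp
    then show ?thesis
      using mult_neg_pos[of C "2 ^ p"] by (metis not_le zero_less_numeral zero_less_power)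
  qed
  have bd: "norm (F j (?W t)) \<le> C * 2 ^ p * norm (?W t) ^ p" for j t
  proof -
    have "1 \<le> norm (?W t)" using complex_Re_le_cmod[of "?W t"] by simp
    then have "(1 + norm (?W t)) ^ p \<le> (2 * norm (?W t)) ^ p"
      by (intro power_mono) auto
    then have "C * (1 + norm (?W t)) ^ p \<le> C * (2 * norm (?W t)) ^ p"
      using C by (rule mult_left_mono)
    then show ?thesis using bound[of "?W t" j] by (simp add: power_mult_distrib mult.assoc)
  qed
  have "(\<lambda>j. ?J (F j)) \<longlonglongrightarrow> ?J f"
  proof (rule integral_dominated_convergence)
    show "(\<lambda>t. f (?W t) * exp (of_real y * ?W t) / ?W t ^ Suc k) \<in> borel_measurable lborel"
      using vertical_line_measurable[OF perron_kernel_continuous[OF f], of 1] by (simp del: power_Suc)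
    show "(\<lambda>t. F j (?W t) * exp (of_real y * ?W t) / ?W t ^ Suc k) \<in> borel_measurable lborel" for j
      using vertical_line_measurable[OF perron_kernel_continuous[OF holomorphic_on_imp_continuous_on[OF holo]], of 1]
      by (simp del: power_Suc)
    show "integrable lborel (\<lambda>t. (C * 2 ^ p * exp y) / (1 + t\<^sup>2))"
      by (rule integrable_inverse_one_plus_square)
    show "AE t in lborel. norm (F j (?W t) * exp (of_real y * ?W t) / ?W t ^ Suc k) \<le> (C * 2 ^ p * exp y) / (1 + t\<^sup>2)" for j
      using perron_kernel_bound[where c = 1 and n = "Suc k" and y = y, OF _ _ bd] k by (simp del: power_Suc)
    show "AE t in lborel. (\<lambda>j. F j (?W t) * exp (of_real y * ?W t) / ?W t ^ Suc k)
        \<longlonglongrightarrow> f (?W t) * exp (of_real y * ?W t) / ?W t ^ Suc k"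
      by (intro AE_I2 tendsto_divide tendsto_mult tendsto_const lim power_not_zero) (auto simp: complex_eq_iff)
  qed
  then have "(\<lambda>j. of_real (2 * pi / fact k) * riesz_sum lam k (a j) y) \<longlonglongrightarrow> ?J f"
    using perron_formula[OF freq holo germ bound k, of 1] by (simp del: power_Suc)
  from tendsto_mult[OF tendsto_const[of "of_real (fact k / (2 * pi))"] this] show ?thesis
    by (auto simp: convergent_def mult.assoc[symmetric] simp flip: of_real_mult)
qed

text \<open>A triangular system: at y = lam (n + 1) the Riesz sum contains exactly the coefficients
  up to n, and the last one has the nonzero factor (lam (n + 1) - lam n)^k.\<close>

lemma coefficients_convergent:
  assumes freq: "frequency lam" and conv: "\<And>y. convergent (\<lambda>j. riesz_sum lam k (a j) y)"
  shows "convergent (\<lambda>j. a j n)"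
proof (induction n rule: less_induct)
  case (less n)
  have mono: "strict_mono lam" using freq by (simp add: frequency_def)
  define d where "d i = complex_of_real ((lam (Suc n) - lam i) ^ k)" for i
  have d: "d n \<noteq> 0"
    using strict_monoD[OF mono, of n "Suc n"] by (simp add: d_def)
  have set: "{i. lam i < lam (Suc n)} = {..<Suc n}"
    using strict_mono_less[OF mono] by auto
  have "a j n = (riesz_sum lam k (a j) (lam (Suc n)) - (\<Sum>i<n. a j i * d i)) * inverse (d n)" for j
    using d unfolding riesz_sum_def set by (simp add: d_def)
  moreover have "convergent (\<lambda>j. (riesz_sum lam k (a j) (lam (Suc n)) - (\<Sum>i<n. a j i * d i)) * inverse (d n))"
    using less by (intro convergent_mult convergent_diff convergent_sum conv convergent_const) auto
  ultimately show ?case by simp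
qed

text \<open>The bound is independent of s. At a fixed cutoff x, convergence of finitely many
  coefficients therefore gives uniform convergence of the Riesz means on the half-plane.\<close>

lemma norm_riesz_mean_le:
  assumes freq: "frequency lam" and "0 < x" "0 \<le> m" "0 \<le> Re s"
  shows "norm (riesz_mean lam m a x s) \<le> (\<Sum>n | lam n < x. norm (a n))"
  unfolding riesz_mean_def
proof (rule sum_norm_le)
  fix n assume n: "n \<in> {n. lam n < x}"
  have lam: "0 \<le> lam n" using freq by (simp add: frequency_def)
  have "(1 - lam n / x) powr m \<le> 1"
    using n lam assms by (intro powr_le1) (auto simp: field_simps)
  moreover have "norm (exp (- of_real (lam n) * s)) \<le> 1"
    using lam assms by (simp add: mult_nonneg_nonneg)
  ultimately have "norm (exp (- of_real (lam n) * s)) * (1 - lam n / x) powr m \<le> 1 * 1"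
    by (intro mult_mono) auto
  then have "norm (a n) * (norm (exp (- of_real (lam n) * s)) * (1 - lam n / x) powr m) \<le> norm (a n) * 1"
    by (intro mult_left_mono) auto
  then show "norm (a n * exp (- of_real (lam n) * s) * of_real ((1 - lam n / x) powr m)) \<le> norm (a n)"
    by (simp add: norm_mult mult.assoc)
qed

lemma riesz_mean_diff:
  "riesz_mean lam m a x s - riesz_mean lam m b x s = riesz_mean lam m (\<lambda>n. a n - b n) x s"
  by (simp add: riesz_mean_def left_diff_distrib sum_subtractf)

section \<open>The weighted norm, translation and the convergent subsequence\<close>

lemma norm_inf_bounds:
  assumes "\<And>s. 0 < Re s \<Longrightarrow> norm (f s) \<le> B * (1 + norm s) powr l"
  shows "bdd_above ((\<lambda>s. norm (f s) / (1 + norm s) powr l) ` half_plane 0)"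
    and "0 \<le> norm_inf l f" and "norm_inf l f \<le> B"
proof -
  have le: "norm (f s) / (1 + norm s) powr l \<le> B" if "s \<in> half_plane 0" for s
  proof -
    have "0 < (1 + norm s) powr l"
      using norm_ge_zero[of s] by (simp add: add_nonneg_eq_0_iff)
    then show ?thesis using assms[of s] that by (simp add: divide_le_eq)
  qed
  then show bdd: "bdd_above ((\<lambda>s. norm (f s) / (1 + norm s) powr l) ` half_plane 0)"
    by (intro bdd_aboveI2[where M = B])
  have one: "1 \<in> half_plane 0" by simp
  then have ne: "half_plane 0 \<noteq> {}" by blast
  show "0 \<le> norm_inf l f"
    unfolding norm_inf_def by (rule cSUP_upper2[OF bdd one]) simp
  show "norm_inf l f \<le> B"
    unfolding norm_inf_def by (rule cSUP_least[OF ne le])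
qed

lemma H_inf_bound:
  assumes "f \<in> H_inf lam l" "0 < Re s"
  shows "norm (f s) \<le> norm_inf l f * (1 + norm s) powr l"
proof -
  have "0 < (1 + norm s) powr l"
    using norm_ge_zero[of s] by (simp add: add_nonneg_eq_0_iff)
  moreover have "norm (f s) / (1 + norm s) powr l \<le> norm_inf l f"
    unfolding norm_inf_def using assms by (intro cSUP_upper) (auto simp: H_inf_def)
  ultimately show ?thesis by (simp add: divide_le_eq)
qed

lemma weight_translate:
  fixes s :: complex
  assumes "0 \<le> l" "0 \<le> u"
  shows "(1 + norm (of_real u + s)) powr l \<le> (1 + u) powr l * (1 + norm s) powr l"
  using weight_add_le[OF assms(1), of "of_real u" s] assms(2) by simp

lemma H_inf_translate:
  assumes f: "f \<in> H_inf lam l" and l: "0 \<le> l" and u: "0 \<le> u"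
  shows "(\<lambda>s. f (of_real u + s)) \<in> H_inf lam l"
proof -
  have "norm (f (of_real u + s)) \<le> (norm_inf l f * (1 + u) powr l) * (1 + norm s) powr l" if "0 < Re s" for s
  proof -
    have "0 \<le> norm_inf l f"
      using norm_inf_bounds(2)[OF H_inf_bound[OF f]] .
    then have "norm_inf l f * (1 + norm (of_real u + s)) powr l \<le> norm_inf l f * ((1 + u) powr l * (1 + norm s) powr l)"
      by (intro mult_left_mono weight_translate l u)
    then show ?thesis
      using H_inf_bound[OF f, of "of_real u + s"] that u by (simp add: mult.assoc)
  qed
  from norm_inf_bounds(1)[OF this] show ?thesis
    using f u holomorphic_on_translate[of f "of_real u"] riesz_germ_translate[of lam _ f "of_real u"]
    by (auto simp: H_inf_def)
qed

theorem theorem3p14: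
  fixes lam :: "nat \<Rightarrow> real" and l :: real and F :: "nat \<Rightarrow> complex \<Rightarrow> complex"
  assumes "frequency lam"
    and "l \<ge> 0"
    and "bounded_seq_in_H_inf lam l F"
  shows "\<exists>r :: nat \<Rightarrow> nat. \<exists>f. strict_mono r \<and> f \<in> H_inf lam l \<and>
    (\<forall>u::real. u > 0 \<longrightarrow>
      converges_in_H_inf lam l (\<lambda>j s. F (r j) (of_real u + s)) (\<lambda>s. f (of_real u + s)))"
proof -
  note freq = assms(1) and l = assms(2)
  obtain C where FH: "\<And>N. F N \<in> H_inf lam l" and FC: "\<And>N. norm_inf l (F N) \<le> C"
    using assms(3) unfolding bounded_seq_in_H_inf_def by blast
  have C: "0 \<le> C"
    using norm_inf_bounds(2)[OF H_inf_bound[OF FH[of 0]]] FC[of 0] by linarith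
  have Fholo: "F N holomorphic_on half_plane 0" for N
    using FH by (simp add: H_inf_def)
  obtain b where Fgerm: "\<And>N. riesz_germ lam (b N) (F N)"
    using FH unfolding H_inf_def mem_Collect_eq by metis
  have Fbound: "norm (F N s) \<le> C * (1 + norm s) powr l" if "0 < Re s" for N s
    by (rule order_trans[OF H_inf_bound[OF FH that] mult_right_mono[OF FC]]) simp
  obtain f r where fholo: "f holomorphic_on half_plane 0" and r: "strict_mono (r :: nat \<Rightarrow> nat)"
    and flim: "\<And>s. s \<in> half_plane 0 \<Longrightarrow> (\<lambda>j. F (r j) s) \<longlonglongrightarrow> f s"
  proof (rule Montel[of "half_plane 0" "range F" F])
    show "open (half_plane 0)" by (rule open_half_plane)
    show "h holomorphic_on half_plane 0" if "h \<in> range F" for h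
      using that Fholo by auto
    show "\<exists>B. \<forall>h\<in>range F. \<forall>z\<in>K. norm (h z) \<le> B" if K: "compact K" "K \<subseteq> half_plane 0" for K
    proof -
      obtain R where R: "\<And>z. z \<in> K \<Longrightarrow> norm z \<le> R"
        using compact_imp_bounded[OF K(1)] unfolding bounded_iff by blast
      have "norm (F N z) \<le> C * (1 + R) powr l" if "z \<in> K" for N z
      proof -
        have "C * (1 + norm z) powr l \<le> C * (1 + R) powr l"
          using R[OF that] C l by (intro mult_left_mono powr_mono2) auto
        then show ?thesis
          using Fbound[of z N] that K(2) by force
      qed
      then show ?thesis by blast
    qed
  qed auto
  have fbound: "norm (f s) \<le> C * (1 + norm s) powr l" if "0 < Re s" for s
    using flim[of s] Fbound[OF that] that by (intro tendsto_upperbound[OF tendsto_norm]) auto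
  define p k where "p = nat \<lceil>l\<rceil>" and "k = nat \<lceil>l\<rceil> + 2"
  have "convergent (\<lambda>j. riesz_sum lam k (b (r j)) y)" for y
  proof (rule riesz_sum_tendsto[OF freq Fholo Fgerm])
    fix j s assume s: "0 < Re s"
    have "C * (1 + norm s) powr l \<le> C * (1 + norm s) ^ p"
      unfolding p_def using C by (intro mult_left_mono weight_le_power) auto
    then show "norm (F (r j) s) \<le> C * (1 + norm s) ^ p"
      using Fbound[OF s, of "r j"] by linarith
  next
    show "p + 2 \<le> k" by (simp add: p_def k_def)
    show "continuous_on (half_plane 0) f"
      by (rule holomorphic_on_imp_continuous_on[OF fholo])
    show "(\<lambda>j. F (r j) s) \<longlonglongrightarrow> f s" if "0 < Re s" for s
      using flim[of s] that by simp
  qed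
  then have "convergent (\<lambda>j. b (r j) n)" for n
    by (rule coefficients_convergent[OF freq])
  then obtain \<alpha> where \<alpha>: "\<And>n. (\<lambda>j. b (r j) n) \<longlonglongrightarrow> \<alpha> n"
    unfolding convergent_def by metis
  \<comment> \<open>The approximation lemma cannot be applied to f, whose germ is still to be found.
    Its estimate for \<open>F (r j)\<close> has a constant independent of j, so it passes to the
    limit at fixed x and s.\<close>
  have approx: "\<exists>D\<ge>0. \<forall>x\<ge>1. \<forall>s. u < Re s \<longrightarrow>
      (\<forall>j. norm (riesz_mean lam (real k) (b (r j)) x s - F (r j) s) \<le> D / x * (1 + norm s) powr l) \<and>
      norm (riesz_mean lam (real k) \<alpha> x s - f s) \<le> D / x * (1 + norm s) powr l" if u: "0 < u" for u
  proof (rule riesz_approximation[OF freq l u, folded k_def], goal_cases)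
    case (1 D)
    note D = 1(1) and approx = 1(2)[OF Fholo Fgerm C Fbound]
    have "norm (riesz_mean lam (real k) \<alpha> x s - f s) \<le> D * C / x * (1 + norm s) powr l"
      if "1 \<le> x" "u < Re s" for x s
    proof (rule tendsto_upperbound[OF tendsto_norm])
      show "(\<lambda>j. riesz_mean lam (real k) (b (r j)) x s - F (r j) s) \<longlonglongrightarrow> riesz_mean lam (real k) \<alpha> x s - f s"
        unfolding riesz_mean_def using that u by (intro tendsto_intros \<alpha> flim) simp
    qed (use approx that in auto)
    then show ?thesis
      using D C approx by (intro exI[of _ "D * C"]) auto
  qed
  \<comment> \<open>The estimate with u = 1, for x tending to infinity, shows that \<alpha> is a
    germ of f of order k with abscissa 1.\<close>
  have "\<forall>s\<in>half_plane 1. ((\<lambda>x. riesz_mean lam (real k) \<alpha> x s) \<longlongrightarrow> f s) at_top"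
  proof
    fix s :: complex assume "s \<in> half_plane 1"
    then obtain D where D: "\<And>x. 1 \<le> x \<Longrightarrow> norm (riesz_mean lam (real k) \<alpha> x s - f s) \<le> D / x * (1 + norm s) powr l"
      using approx[of 1] by auto
    have ev: "\<forall>\<^sub>F x in at_top. norm (riesz_mean lam (real k) \<alpha> x s - f s) \<le> D / x * (1 + norm s) powr l"
      using eventually_ge_at_top[of 1] by eventually_elim (rule D)
    have "((\<lambda>x. D / x) \<longlongrightarrow> 0) at_top"
      by real_asymp
    from Lim_null_comparison[OF ev tendsto_mult_left_zero[OF this]]
    show "((\<lambda>x. riesz_mean lam (real k) \<alpha> x s) \<longlongrightarrow> f s) at_top"
      by (simp add: LIM_zero_iff)
  qed
  then have fgerm: "riesz_germ lam \<alpha> f"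
    unfolding riesz_germ_def using of_nat_0_le_iff[of k] zero_le_one by blast
  have fH: "f \<in> H_inf lam l"
    using fholo fgerm norm_inf_bounds(1)[OF fbound] by (auto simp: H_inf_def)
  have "converges_in_H_inf lam l (\<lambda>j s. F (r j) (of_real u + s)) (\<lambda>s. f (of_real u + s))" if u: "0 < u" for u :: real
  proof -
    obtain D where D: "0 \<le> D" and approxF: "\<And>x s j. 1 \<le> x \<Longrightarrow> u < Re s \<Longrightarrow>
        norm (riesz_mean lam (real k) (b (r j)) x s - F (r j) s) \<le> D / x * (1 + norm s) powr l"
      and approxf: "\<And>x s. 1 \<le> x \<Longrightarrow> u < Re s \<Longrightarrow>
        norm (riesz_mean lam (real k) \<alpha> x s - f s) \<le> D / x * (1 + norm s) powr l"
      using approx[OF u] by blast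
    define U where "U = (1 + u) powr l"
    have U: "0 < U" using u by (simp add: U_def)
    define \<delta> where "\<delta> x j = (\<Sum>n | lam n < x. norm (b (r j) n - \<alpha> n))" for x j
    \<comment> \<open>Two errors D / x from replacing the functions by their Riesz means, and
      \<delta> from comparing the two finite means; \<open>U\<close> pays for moving the weight from
      u + s back to s.\<close>
    have key: "norm (F (r j) (of_real u + s) - f (of_real u + s)) \<le> ((2 * D / x + \<delta> x j) * U) * (1 + norm s) powr l"
      if x: "1 \<le> x" and s: "0 < Re s" for x j s
    proof -
      let ?s = "of_real u + s" and ?w = "(1 + norm (of_real u + s)) powr l"
      have Re: "u < Re ?s" using s by simp
      have \<delta>0: "0 \<le> \<delta> x j" unfolding \<delta>_def by (intro sum_nonneg) auto
      have "norm (riesz_mean lam (real k) (b (r j)) x ?s - riesz_mean lam (real k) \<alpha> x ?s) \<le> \<delta> x j"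
        unfolding riesz_mean_diff \<delta>_def using Re x u by (intro norm_riesz_mean_le freq) auto
      also have "\<dots> \<le> \<delta> x j * ?w"
        using mult_left_mono[OF one_le_weight[OF l, of ?s] \<delta>0] by simp
      finally have mid: "norm (riesz_mean lam (real k) (b (r j)) x ?s - riesz_mean lam (real k) \<alpha> x ?s) \<le> \<delta> x j * ?w" .
      have "F (r j) ?s - f ?s = (riesz_mean lam (real k) (b (r j)) x ?s - riesz_mean lam (real k) \<alpha> x ?s)
          + (riesz_mean lam (real k) \<alpha> x ?s - f ?s) - (riesz_mean lam (real k) (b (r j)) x ?s - F (r j) ?s)"
        by simp
      then have "norm (F (r j) ?s - f ?s) \<le> \<delta> x j * ?w + D / x * ?w + D / x * ?w"
        using mid approxf[OF x Re] approxF[OF x Re, of j]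
        by (smt (verit) norm_triangle_ineq norm_triangle_ineq4)
      also have "\<dots> = (2 * D / x + \<delta> x j) * ?w"
        by (simp add: algebra_simps)
      also have "\<dots> \<le> (2 * D / x + \<delta> x j) * (U * (1 + norm s) powr l)"
        unfolding U_def using D x \<delta>0 u by (intro mult_left_mono weight_translate l) auto
      finally show ?thesis by (simp add: mult.assoc)
    qed
    have "(\<lambda>j. norm_inf l (\<lambda>s. F (r j) (of_real u + s) - f (of_real u + s))) \<longlonglongrightarrow> 0"
    proof (rule tendstoI)
      fix e :: real assume e: "0 < e"
      \<comment> \<open>The cutoff is fixed first, so that both approximation errors together stay
        below e / 2. Then \<delta> is a fixed finite sum, which tends to 0 in j.\<close>
      define x where "x = max 1 (4 * D * U / e + 1)"
      have x: "1 \<le> x" "4 * D * U / e < x" by (auto simp: x_def)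
      have small: "2 * D / x * U < e / 2"
        using x e by (simp add: field_simps)
      have "\<delta> x \<longlonglongrightarrow> (\<Sum>n | lam n < x. norm (\<alpha> n - \<alpha> n))"
        unfolding \<delta>_def by (intro tendsto_intros \<alpha>)
      then have "(\<lambda>j. \<delta> x j * U) \<longlonglongrightarrow> 0"
        by (simp add: tendsto_mult_left_zero)
      then have "\<forall>\<^sub>F j in sequentially. \<delta> x j * U < e / 2"
        using e by (intro order_tendstoD) auto
      then show "\<forall>\<^sub>F j in sequentially. dist (norm_inf l (\<lambda>s. F (r j) (of_real u + s) - f (of_real u + s))) 0 < e"
      proof eventually_elim
        case (elim j)
        have "(2 * D / x + \<delta> x j) * U < e"
          using elim small by (simp add: distrib_right)
        then show ?case
          using norm_inf_bounds(2,3)[OF key[OF x(1), of _ j]] by (simp add: dist_real_def)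
      qed
    qed
    then show ?thesis
      unfolding converges_in_H_inf_def using H_inf_translate[OF FH l] H_inf_translate[OF fH l] u by auto
  qed
  then show ?thesis using r fH by blast
qed

end
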